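(* Let $n\ge 1$ be an integer and $s\in(0,1)$. For $\alpha\ge 0$ and $1\le p<\infty$ let $C_p\in(0,+\infty]$ denote the best constant (depending on $n,s,\alpha,p$) in the inequality $$ \int_{\mathbb{R}^n} \frac{|(\mathbb{P}_s u)(x,y)|^p}{(|x|^2+y^2)^{\alpha}}\,dx\le C_p\int_{\mathbb{R}^n} \frac{|u(x)|^p}{(|x|^2+y^2)^{\alpha}}\,dx, \qquad ( * ) $$ required for all $y>0$ and all $u$, where $\mathbb{P}_s u$ is the $s$-harmonic extension of $u$. (i) If $0\le\alpha\le \frac n2-s$, then for arbitrary $1\le p<\infty$ the best constant in $( * )$ is $C_p=1$. (ii) If $\alpha>\frac n2$, then the best constant $C_p$ in $( * )$ is greater than $1$ at least for $p$ close to $1^+$; that is, there exists $p_0>1$ (depending on $n,s,\alpha$) such that $C_p>1$ for all $p\in[1,p_0)$.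
   Context: For $s\in(0,1)$ and a measurable function $u:\mathbb{R}^n\to\mathbb{R}$, the generalized $s$-harmonic extension of $u$ to the half-space $\mathbb{R}^{n}\times(0,\infty)$ is $$ (\mathbb{P}_s u)(x,y)=c_{n,s}\int_{\mathbb{R}^n} u(\xi)\,\frac{y^{2s}}{(|x-\xi|^2+y^2)^{\frac{n+2s}{2}}}\,d\xi,\qquad x\in\mathbb{R}^n,\ y>0,\qquad c_{n,s}=\frac{\Gamma\big(\frac{n+2s}{2}\big)}{\pi^{n/2}\,\Gamma(s)}. $$ A finite constant $C>0$ is admissible in $( * )$ if, for every $y>0$ and every measurable $u$ for which $\int_{\mathbb{R}^n}|u(x)|^p(|x|^2+y^2)^{-\alpha}\,dx$ is finite, the integral defining $(\mathbb{P}_s u)(x,y)$ converges absolutely for a.e. $x\in\mathbb{R}^n$ and $( * )$ is satisfied with $C$ in place of $C_p$ (so $C$ does not depend on $y$ or $u$). The best constant $C_p$ is the infimum of all admissible constants, with $C_p=+\infty$ if there is none. *)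

theory Defs
  imports "HOL-Analysis.Analysis"
begin

definition poisson_const :: "nat \<Rightarrow> real \<Rightarrow> real" where
  "poisson_const n s = Gamma ((real n + 2 * s) / 2) / (pi powr (real n / 2) * Gamma s)"

definition ext_integrand ::
  "real \<Rightarrow> (real ^ 'n::finite \<Rightarrow> real) \<Rightarrow> real ^ 'n \<Rightarrow> real \<Rightarrow> real ^ 'n \<Rightarrow> real" where
  "ext_integrand s u x y \<xi> =
     u \<xi> * (y powr (2 * s) /
       ((norm (x - \<xi>))\<^sup>2 + y\<^sup>2) powr ((real CARD('n) + 2 * s) / 2))"

definition harmonic_ext ::
  "real \<Rightarrow> (real ^ 'n::finite \<Rightarrow> real) \<Rightarrow> real ^ 'n \<Rightarrow> real \<Rightarrow> real" where
  "harmonic_ext s u x y =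
     poisson_const CARD('n) s * (\<integral>\<xi>. ext_integrand s u x y \<xi> \<partial>lebesgue)"

definition weighted_integral ::
  "real \<Rightarrow> real \<Rightarrow> real \<Rightarrow> (real ^ 'n::finite \<Rightarrow> real) \<Rightarrow> ennreal" where
  "weighted_integral \<alpha> p y f =
     (\<integral>\<^sup>+x. ennreal (\<bar>f x\<bar> powr p / ((norm x)\<^sup>2 + y\<^sup>2) powr \<alpha>) \<partial>lebesgue)"

text \<open>
  A Bochner integral that does not converge absolutely has the value 0, so
  convergence almost everywhere is demanded explicitly. The type argument
  carries the dimension \<open>n = CARD('n)\<close>.
\<close>

definition admissible_const ::
  "'n::finite itself \<Rightarrow> real \<Rightarrow> real \<Rightarrow> real \<Rightarrow> real \<Rightarrow> bool" where
  "admissible_const T s \<alpha> p C \<longleftrightarrow>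
     C > 0 \<and>
     (\<forall>y>0. \<forall>u :: real ^ 'n \<Rightarrow> real.
        u \<in> borel_measurable lebesgue \<longrightarrow> weighted_integral \<alpha> p y u < \<infinity> \<longrightarrow>
          (AE x in lebesgue. integrable lebesgue (ext_integrand s u x y)) \<and>
          weighted_integral \<alpha> p y (\<lambda>x. harmonic_ext s u x y)
            \<le> ennreal C * weighted_integral \<alpha> p y u)"

text \<open>In \<^typ>\<open>ennreal\<close> the infimum of the empty set is \<open>\<infinity>\<close>.\<close>

definition best_const ::
  "'n::finite itself \<Rightarrow> real \<Rightarrow> real \<Rightarrow> real \<Rightarrow> ennreal" where
  "best_const T s \<alpha> p = Inf (ennreal ` {C. admissible_const T s \<alpha> p C})"

end

theory Submission
  imports Defs "HOL-Probability.Distributions" "HOL-Real_Asymp.Real_Asymp"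
begin

text \<open>
  Write \<open>P\<close> for convolution with the Poisson kernel
  \<open>c y powr (2 s) (|z|\<^sup>2 + y\<^sup>2) powr (- (n/2 + s))\<close>, a symmetric probability density, and
  \<open>w(x) = (|x|\<^sup>2 + y\<^sup>2) powr (- \<alpha>)\<close>. Jensen's inequality gives \<open>|P u|\<^sup>p \<le> P(|u|\<^sup>p)\<close>, and by symmetry
  \<open>\<integral> P(|u|\<^sup>p) w = \<integral> |u|\<^sup>p P w\<close>. So everything depends on how \<open>P w\<close> compares with \<open>w\<close>.

  If \<open>\<alpha> \<le> n/2 - s\<close>, then \<open>P w \<le> w\<close>, hence the constant 1 is admissible. The reason is that
  \<open>(|x|\<^sup>2 + y\<^sup>2) powr (- b)\<close> with \<open>b = n/2 - s\<close> is the extension of \<open>|x| powr (- 2 b)\<close>, the fundamental solution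
  of the degenerate elliptic equation behind \<open>P\<close>; since \<open>w \<le> |x| powr (- 2 b)\<close> when \<open>\<alpha> = b\<close>, it follows
  that \<open>P w \<le> P |x| powr (- 2 b) = w\<close> (\<open>weight_convolution_le\<close>). Smaller exponents are powers \<open>w\<^sup>\<theta>\<close>
  with \<open>\<theta> \<le> 1\<close> and inherit the bound by concavity (\<open>poisson_avg_weight_le\<close>).

  No constant below 1 is admissible, for any \<open>\<alpha> \<ge> 0\<close>: on a large ball the extension of its
  indicator is close to 1 up to a boundary layer of fixed width \<open>M\<close>, so an admissible \<open>C < 1\<close>
  would make the \<open>w\<close>-mass of balls grow by a fixed factor each time the radius grows by \<open>M\<close>,
  that is exponentially, whereas it is at most of order \<open>r\<^sup>n\<close> (\<open>admissible_const_ge_1\<close>).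

  If \<open>\<alpha> > n/2\<close>, then \<open>w\<close> is integrable and \<open>\<integral> P w = \<integral> w\<close>. At height 1 the value \<open>w(0) = 1\<close> is
  a strict maximum, so \<open>P w < w\<close> near the origin, and the lost mass must reappear outside a
  small ball \<open>B\<close>. For \<open>p = 1\<close> the indicator of the complement of \<open>B\<close> therefore gives a quotient
  strictly above 1 (\<open>exterior_mass_increases\<close>). For this test function the right-hand side does
  not depend on \<open>p\<close>, and replacing \<open>P u \<in> [0, 1]\<close> by \<open>(P u)\<^sup>p\<close> costs at most \<open>(p - 1) \<integral> w\<close>, so the
  gain survives for all \<open>p\<close> near 1 (\<open>admissible_const_gap\<close>).
\<close>

section \<open>Powers as mixtures of Gaussians\<close>

text \<open>
  The density of the Mellin transform on the half-line, extended by 0 so that integrals over it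
  can be taken over all of \<open>lborel\<close>, where translations and dilations are available.
\<close>

definition mellin_weight :: "real \<Rightarrow> real \<Rightarrow> real" where
  "mellin_weight a t = (if 0 < t then t powr (a - 1) else 0)"

definition weight :: "real \<Rightarrow> real \<Rightarrow> 'a::euclidean_space \<Rightarrow> real" where
  "weight a y x = ((norm x)\<^sup>2 + y\<^sup>2) powr (- a)"

lemma mellin_weight_measurable [measurable]: "mellin_weight a \<in> borel_measurable borel"
  unfolding mellin_weight_def by measurable

lemma mellin_weight_nonneg [simp]: "0 \<le> mellin_weight a t"
  by (simp add: mellin_weight_def)

lemma weight_measurable [measurable]: "weight a y \<in> borel_measurable borel"
  unfolding weight_def by measurable

lemma weight_nonneg [simp]: "0 \<le> weight a y x"
  by (simp add: weight_def)

lemma norm_sq_plus_pos: "0 < y \<Longrightarrow> 0 < (norm x)\<^sup>2 + (y::real)\<^sup>2"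
  by (simp add: add_nonneg_pos)

lemma weight_pos: "0 < y \<Longrightarrow> 0 < weight a y x"
  using norm_sq_plus_pos[of y x] by (simp add: weight_def)

lemma nn_integral_mellin_weight:
  assumes "0 < a" "0 < A"
  shows "(\<integral>\<^sup>+t. ennreal (mellin_weight a t * exp (- (t * A))) \<partial>lborel)
    = ennreal (Gamma a * A powr (- a))"
proof -
  let ?f = "\<lambda>t. ennreal (indicator {0..} t * t powr (a - 1) / exp t)"
  have pt: "?f (0 + A * t) = ennreal (A powr (a - 1)) * ennreal (mellin_weight a t * exp (- (t * A)))"
    (is "?l t = ?r t") if "t \<noteq> 0" for t
    using assms that
    by (auto simp: mellin_weight_def indicator_def powr_mult exp_minus field_simps
        zero_le_mult_iff simp flip: ennreal_mult')
  have ae: "AE t in lborel. ?l t = ?r t"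
    using pt AE_lborel_singleton[of "0::real"] by (auto elim: eventually_mono)
  have "ennreal (Gamma a) = (\<integral>\<^sup>+t. ?f t \<partial>lborel)"
    using Gamma_conv_nn_integral_real[OF assms(1)] .
  also have "\<dots> = ennreal \<bar>A\<bar> * (\<integral>\<^sup>+t. ?f (0 + A * t) \<partial>lborel)"
    using assms by (intro nn_integral_real_affine) auto
  also have "(\<integral>\<^sup>+t. ?f (0 + A * t) \<partial>lborel)
      = ennreal (A powr (a - 1)) * (\<integral>\<^sup>+t. ennreal (mellin_weight a t * exp (- (t * A))) \<partial>lborel)"
    by (subst nn_integral_cong_AE[OF ae]) (simp add: nn_integral_cmult)
  also have "ennreal \<bar>A\<bar> * \<dots>
      = ennreal (A powr a) * (\<integral>\<^sup>+t. ennreal (mellin_weight a t * exp (- (t * A))) \<partial>lborel)"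
    using assms by (simp add: mult.assoc[symmetric] powr_diff flip: ennreal_mult')
  finally have "ennreal (A powr (- a)) * ennreal (Gamma a) = ennreal (A powr (- a)) * (ennreal (A powr a)
      * (\<integral>\<^sup>+t. ennreal (mellin_weight a t * exp (- (t * A))) \<partial>lborel))"
    by simp
  also have "\<dots> = (\<integral>\<^sup>+t. ennreal (mellin_weight a t * exp (- (t * A))) \<partial>lborel)"
    using assms by (simp add: mult.assoc[symmetric] powr_minus flip: ennreal_mult')
  finally show ?thesis
    using assms by (simp add: mult.commute flip: ennreal_mult')
qed

text \<open>
  Powers of \<open>|x|\<^sup>2 + y\<^sup>2\<close> are superpositions of Gaussians. This replaces convolutions of such
  powers by convolutions of Gaussians, which are explicit.
\<close>

lemma weight_eq_gaussian_mixture: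
  assumes "0 < a" "0 < y"
  shows "ennreal (weight a y x) = ennreal (1 / Gamma a) *
    (\<integral>\<^sup>+t. ennreal (mellin_weight a t * exp (- (t * ((norm x)\<^sup>2 + y\<^sup>2)))) \<partial>lborel)"
  using assms Gamma_real_pos[of a, THEN less_imp_neq]
  by (subst nn_integral_mellin_weight)
     (auto simp: norm_sq_plus_pos weight_def simp flip: ennreal_mult')

lemma nn_integral_translate:
  fixes c :: "'a::euclidean_space"
  assumes [measurable]: "f \<in> borel_measurable borel"
  shows "(\<integral>\<^sup>+x. f (x - c) \<partial>lborel) = (\<integral>\<^sup>+x. f x \<partial>lborel)"
proof -
  have "(\<integral>\<^sup>+x. f x \<partial>lborel) = (\<integral>\<^sup>+x. f x \<partial>distr lborel borel ((+) (- c)))"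
    by (simp only: lborel_distr_plus)
  then show ?thesis
    by (simp add: nn_integral_distr)
qed

lemma nn_integral_gaussian_1d:
  assumes "0 < t"
  shows "(\<integral>\<^sup>+x. ennreal (exp (- (t * x\<^sup>2))) \<partial>lborel) = ennreal (sqrt (pi / t))"
proof -
  define \<sigma> where "\<sigma> = 1 / sqrt (2 * t)"
  have \<sigma>: "0 < \<sigma>" "\<sigma>\<^sup>2 = 1 / (2 * t)"
    using assms by (auto simp: \<sigma>_def power_divide)
  interpret N: prob_space "density lborel (normal_density 0 \<sigma>)"
    by (rule prob_space_normal_density) fact
  have "exp (- (t * x\<^sup>2)) = sqrt (pi / t) * normal_density 0 \<sigma> x" for x
    using assms by (simp add: normal_density_def \<sigma> real_sqrt_divide)
  then have "(\<integral>\<^sup>+x. ennreal (exp (- (t * x\<^sup>2))) \<partial>lborel)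
      = ennreal (sqrt (pi / t)) * (\<integral>\<^sup>+x. ennreal (normal_density 0 \<sigma> x) \<partial>lborel)"
    using assms by (simp add: ennreal_mult normal_density_nonneg nn_integral_cmult)
  also have "(\<integral>\<^sup>+x. ennreal (normal_density 0 \<sigma> x) \<partial>lborel) = 1"
    using N.emeasure_space_1 by (simp add: emeasure_density)
  finally show ?thesis by simp
qed

text \<open>
  The Gaussian factorises over the coordinates.
\<close>

lemma nn_integral_gaussian:
  fixes c :: "'a::euclidean_space"
  assumes "0 < t"
  shows "(\<integral>\<^sup>+x. ennreal (exp (- (t * (norm (x - c))\<^sup>2))) \<partial>lborel)
    = ennreal ((pi / t) powr (real DIM('a) / 2))"
proof -
  have norm_sq: "(norm x)\<^sup>2 = (\<Sum>b\<in>Basis. (x \<bullet> b)\<^sup>2)" for x :: 'a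
    unfolding power2_norm_eq_inner by (subst euclidean_inner) (simp add: power2_eq_square)
  have "(\<integral>\<^sup>+x. ennreal (exp (- (t * (norm (x - c))\<^sup>2))) \<partial>lborel)
      = (\<integral>\<^sup>+(x::'a). ennreal (exp (- (t * (norm x)\<^sup>2))) \<partial>lborel)"
    by (rule nn_integral_translate) measurable
  also have "\<dots> = (\<integral>\<^sup>+(x::'a). (\<Prod>b\<in>Basis. ennreal (exp (- (t * (x \<bullet> b)\<^sup>2)))) \<partial>lborel)"
    by (simp add: prod_ennreal norm_sq sum_distrib_left flip: sum_negf exp_sum)
  also have "\<dots> = (\<Prod>b\<in>(Basis::'a set). (\<integral>\<^sup>+x. ennreal (exp (- (t * x\<^sup>2))) \<partial>lborel))"
    by (rule nn_integral_lborel_prod) auto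
  also have "\<dots> = ennreal (sqrt (pi / t) ^ DIM('a))"
    using assms by (simp add: nn_integral_gaussian_1d ennreal_power)
  also have "sqrt (pi / t) ^ DIM('a) = (pi / t) powr (real DIM('a) / 2)"
    using assms by (simp add: powr_half_sqrt[symmetric] powr_powr flip: powr_realpow)
  finally show ?thesis .
qed

text \<open>
  Serves twice: the exponent \<open>n/2 + s\<close> normalises the Poisson kernel, and an exponent \<open>\<alpha> > n/2\<close>
  shows that the weight has finite mass.
\<close>

lemma nn_integral_weight:
  assumes "real DIM('a::euclidean_space) / 2 < a" "0 < y"
  shows "(\<integral>\<^sup>+(x::'a). ennreal (weight a y x) \<partial>lborel)
    = ennreal (pi powr (real DIM('a) / 2) * Gamma (a - real DIM('a) / 2) / Gamma a
        * (y\<^sup>2) powr (real DIM('a) / 2 - a))"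
proof -
  let ?n = "real DIM('a) / 2"
  have a: "0 < a"
    by (rule le_less_trans[OF _ assms(1)]) simp
  have "(\<integral>\<^sup>+(x::'a). ennreal (weight a y x) \<partial>lborel)
    = ennreal (1 / Gamma a) * (\<integral>\<^sup>+(x::'a). \<integral>\<^sup>+t. ennreal (mellin_weight a t * exp (- (t * ((norm x)\<^sup>2 + y\<^sup>2)))) \<partial>lborel \<partial>lborel)"
    using a assms(2) by (subst weight_eq_gaussian_mixture) (auto intro!: nn_integral_cmult)
  also have "(\<integral>\<^sup>+(x::'a). \<integral>\<^sup>+t. ennreal (mellin_weight a t * exp (- (t * ((norm x)\<^sup>2 + y\<^sup>2)))) \<partial>lborel \<partial>lborel)
     = (\<integral>\<^sup>+t. \<integral>\<^sup>+(x::'a). ennreal (mellin_weight a t * exp (- (t * ((norm x)\<^sup>2 + y\<^sup>2)))) \<partial>lborel \<partial>lborel)"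
    by (rule lborel_pair.Fubini') measurable
  also have "\<dots> = (\<integral>\<^sup>+t. ennreal (pi powr ?n) * ennreal (mellin_weight (a - ?n) t * exp (- (t * y\<^sup>2))) \<partial>lborel)"
  proof (rule nn_integral_cong)
    fix t :: real
    show "(\<integral>\<^sup>+(x::'a). ennreal (mellin_weight a t * exp (- (t * ((norm x)\<^sup>2 + y\<^sup>2)))) \<partial>lborel)
      = ennreal (pi powr ?n) * ennreal (mellin_weight (a - ?n) t * exp (- (t * y\<^sup>2)))"
    proof (cases "0 < t")
      case True
      have "(\<integral>\<^sup>+(x::'a). ennreal (mellin_weight a t * exp (- (t * ((norm x)\<^sup>2 + y\<^sup>2)))) \<partial>lborel)
        = (\<integral>\<^sup>+(x::'a). ennreal (mellin_weight a t * exp (- (t * y\<^sup>2))) * ennreal (exp (- (t * (norm (x - 0))\<^sup>2))) \<partial>lborel)"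
        by (simp add: algebra_simps exp_add exp_diff exp_minus divide_simps flip: ennreal_mult')
      also have "\<dots> = ennreal (mellin_weight a t * exp (- (t * y\<^sup>2))) * ennreal ((pi / t) powr ?n)"
        using True by (subst nn_integral_cmult) (measurable, simp only: nn_integral_gaussian)
      also have "\<dots> = ennreal (pi powr ?n) * ennreal (mellin_weight (a - ?n) t * exp (- (t * y\<^sup>2)))"
      proof -
        have "t powr (a - 1) * (pi / t) powr d = pi powr d * t powr (a - d - 1)" for d
        proof -
          have "a - d - 1 = (a - 1) - d" by simp
          then show ?thesis
            using True by (simp only: powr_diff) (simp add: powr_divide powr_diff)
        qed
        then show ?thesis
          using True by (simp add: mellin_weight_def mult_ac flip: ennreal_mult')
      qed
      finally show ?thesis .
    qed (simp add: mellin_weight_def)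
  qed
  also have "\<dots> = ennreal (pi powr ?n) * ennreal (Gamma (a - ?n) * (y\<^sup>2) powr (- (a - ?n)))"
    using assms by (subst nn_integral_cmult) (auto simp: nn_integral_mellin_weight)
  also have "ennreal (1 / Gamma a) * \<dots> = ennreal (pi powr ?n * Gamma (a - ?n) / Gamma a
        * (y\<^sup>2) powr (?n - a))"
    using Gamma_real_pos[OF a] by (simp add: mult_ac flip: ennreal_mult')
  finally show ?thesis .
qed

section \<open>Convolution of the kernel with the extremal weight\<close>

text \<open>
  Completing the square: a product of two Gaussians is a Gaussian times a factor that does not
  depend on \<open>\<xi>\<close>, and the rates in that factor combine like parallel resistors.
\<close>

lemma gaussian_product:
  fixes x \<xi> :: "'a::real_inner"
  assumes "0 < t + r"
  shows "t * (norm (x - \<xi>))\<^sup>2 + r * (norm \<xi>)\<^sup>2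
    = (t + r) * (norm (\<xi> - (t / (t + r)) *\<^sub>R x))\<^sup>2 + t * r / (t + r) * (norm x)\<^sup>2"
proof -
  define k where "k = t / (t + r)"
  have k: "(t + r) * k = t" "t * r / (t + r) = t - t * k"
    using assms by (simp_all add: k_def field_simps)
  have "(t + r) * (norm (\<xi> - k *\<^sub>R x))\<^sup>2
    = (t + r) * (norm \<xi>)\<^sup>2 - 2 * ((t + r) * k) * (x \<bullet> \<xi>) + (t + r) * k * k * (norm x)\<^sup>2"
    by (simp add: power2_norm_eq_inner algebra_simps inner_commute)
  also have "\<dots> = (t + r) * (norm \<xi>)\<^sup>2 - 2 * t * (x \<bullet> \<xi>) + t * k * (norm x)\<^sup>2"
    by (simp only: k)
  finally show ?thesis
    unfolding k(2) k_def[symmetric]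
    by (simp add: power2_norm_eq_inner algebra_simps inner_commute)
qed

lemma nn_integral_gaussian_product:
  fixes x :: "'a::euclidean_space"
  assumes "0 < t" "0 < r"
  shows "(\<integral>\<^sup>+\<xi>. ennreal (exp (- (t * (norm (x - \<xi>))\<^sup>2 + r * (norm \<xi>)\<^sup>2))) \<partial>lborel)
    = ennreal (exp (- (t * r / (t + r) * (norm x)\<^sup>2)) * (pi / (t + r)) powr (real DIM('a) / 2))"
proof -
  have "(\<integral>\<^sup>+\<xi>. ennreal (exp (- (t * (norm (x - \<xi>))\<^sup>2 + r * (norm \<xi>)\<^sup>2))) \<partial>lborel)
    = (\<integral>\<^sup>+\<xi>. ennreal (exp (- (t * r / (t + r) * (norm x)\<^sup>2)))
        * ennreal (exp (- ((t + r) * (norm (\<xi> - (t / (t + r)) *\<^sub>R x))\<^sup>2))) \<partial>lborel)"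
  proof -
    have "exp (- (t * (norm (x - \<xi>))\<^sup>2 + r * (norm \<xi>)\<^sup>2))
      = exp (- (t * r / (t + r) * (norm x)\<^sup>2)) * exp (- ((t + r) * (norm (\<xi> - (t / (t + r)) *\<^sub>R x))\<^sup>2))" for \<xi>
      unfolding gaussian_product[OF add_pos_pos[OF assms]] minus_add_distrib exp_add
      by (rule mult.commute)
    then show ?thesis by (simp add: ennreal_mult')
  qed
  also have "\<dots> = ennreal (exp (- (t * r / (t + r) * (norm x)\<^sup>2)))
        * ennreal ((pi / (t + r)) powr (real DIM('a) / 2))"
    using assms by (subst nn_integral_cmult) (measurable, simp only: nn_integral_gaussian add_pos_pos)
  finally show ?thesis by (simp add: ennreal_mult')
qed

text \<open>
  What remains of the convolution after the integration in space. The substitution \<open>t = r \<tau>\<close>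
  makes the exponent linear in \<open>r\<close>. Since the exponents of the two Mellin weights add up to \<open>2 d\<close>, the
  \<open>r\<close>-integral is of the form \<open>\<Gamma>(d) (\<dots>) powr (- d)\<close>, and the powers of \<open>1 + \<tau>\<close> cancel. Writing the
  result as a Gamma integral in \<open>r\<close> again, now with the exponent \<open>r (X + y\<^sup>2 + \<tau> y\<^sup>2)\<close>, separates the
  two variables.
\<close>

lemma nn_integral_parallel_mixture:
  fixes d s X y :: real
  assumes "0 < s" "s < d" "0 < y" "0 \<le> X"
  shows "(\<integral>\<^sup>+r. \<integral>\<^sup>+t. ennreal (mellin_weight (d + s) t * mellin_weight (d - s) r
        * exp (- (t * y\<^sup>2)) * exp (- (t * r / (t + r) * X)) * (t + r) powr (- d)) \<partial>lborel \<partial>lborel)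
    = ennreal (Gamma s * Gamma (d - s) * (y\<^sup>2) powr (- s) * (X + y\<^sup>2) powr (- (d - s)))"
    (is "?lhs = _")
proof -
  define A where "A = X + y\<^sup>2"
  have A: "0 < A" using assms by (simp add: A_def add_nonneg_pos)
  have y2: "0 < y\<^sup>2" using assms by simp
  have d: "0 < d" using assms by simp
  define F where "F r t = mellin_weight (d + s) t * mellin_weight (d - s) r
        * exp (- (t * y\<^sup>2)) * exp (- (t * r / (t + r) * X)) * (t + r) powr (- d)" for r t :: real
  have [measurable]: "case_prod F \<in> borel_measurable (borel \<Otimes>\<^sub>M borel)"
    unfolding F_def by measurable
  have Fr [measurable]: "F r \<in> borel_measurable borel" for r
    unfolding F_def by measurable
  define G where "G r \<tau> = mellin_weight (d + s) \<tau> * (1 + \<tau>) powr (- d)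
      * (mellin_weight d r * exp (- (r * (\<tau> * y\<^sup>2 + \<tau> / (1 + \<tau>) * X))))" for r \<tau> :: real
  have [measurable]: "case_prod G \<in> borel_measurable (borel \<Otimes>\<^sub>M borel)"
    unfolding G_def by measurable
  have "?lhs = (\<integral>\<^sup>+r. \<integral>\<^sup>+t. ennreal (F r t) \<partial>lborel \<partial>lborel)"
    by (simp add: F_def)
  also have "\<dots> = (\<integral>\<^sup>+r. \<integral>\<^sup>+\<tau>. ennreal (G r \<tau>) \<partial>lborel \<partial>lborel)"
  proof (rule nn_integral_cong)
    fix r :: real
    show "(\<integral>\<^sup>+t. ennreal (F r t) \<partial>lborel) = (\<integral>\<^sup>+\<tau>. ennreal (G r \<tau>) \<partial>lborel)"
    proof (cases "0 < r")
      case True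
      \<comment> \<open>The factor \<open>r\<close> is the Jacobian of \<open>t = r \<tau>\<close>.\<close>
      have FG: "r * F r (r * \<tau>) = G r \<tau>" for \<tau>
      proof (cases "0 < \<tau>")
        case \<tau>: True
        have e: "r * \<tau> + r = r * (1 + \<tau>)" by (simp add: algebra_simps)
        have "r * ((r * \<tau>) powr (d + s - 1) * r powr (d - s - 1) * (r * (1 + \<tau>)) powr (- d))
          = \<tau> powr (d + s - 1) * (1 + \<tau>) powr (- d) * (r powr 1 * r powr (d + s - 1) * r powr (d - s - 1) * r powr (- d))"
          using True \<tau> by (simp add: powr_mult)
        also have "r powr 1 * r powr (d + s - 1) * r powr (d - s - 1) * r powr (- d) = r powr (d - 1)"
          by (simp only: powr_add[symmetric]) (simp add: algebra_simps)
        finally have p: "r * ((r * \<tau>) powr (d + s - 1) * r powr (d - s - 1) * (r * (1 + \<tau>)) powr (- d))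
          = \<tau> powr (d + s - 1) * (1 + \<tau>) powr (- d) * r powr (d - 1)" .
        have q: "r * \<tau> * r / (r * (1 + \<tau>)) * X = r * (\<tau> / (1 + \<tau>) * X)"
          using True by (simp add: mult.assoc)
        have ex: "exp (- (r * \<tau> * y\<^sup>2)) * exp (- (r * (\<tau> / (1 + \<tau>) * X)))
           = exp (- (r * (\<tau> * y\<^sup>2 + \<tau> / (1 + \<tau>) * X)))"
          by (simp add: mult_exp_exp algebra_simps)
        have "r * F r (r * \<tau>) = r * ((r * \<tau>) powr (d + s - 1) * r powr (d - s - 1) * (r * (1 + \<tau>)) powr (- d))
            * (exp (- (r * \<tau> * y\<^sup>2)) * exp (- (r * (\<tau> / (1 + \<tau>) * X))))"
          using True \<tau> unfolding F_def e q by (simp add: mellin_weight_def mult_ac)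
        also have "\<dots> = G r \<tau>"
          unfolding p ex using True \<tau> by (simp add: G_def mellin_weight_def mult_ac)
        finally show ?thesis .
      qed (use True in \<open>simp add: F_def G_def mellin_weight_def zero_less_mult_iff\<close>)
      have "(\<integral>\<^sup>+t. ennreal (F r t) \<partial>lborel) = ennreal \<bar>r\<bar> * (\<integral>\<^sup>+\<tau>. ennreal (F r (0 + r * \<tau>)) \<partial>lborel)"
        using True by (intro nn_integral_real_affine) auto
      also have "\<dots> = (\<integral>\<^sup>+\<tau>. ennreal (G r \<tau>) \<partial>lborel)"
        using True by (subst nn_integral_cmult[symmetric]) (auto simp: FG simp flip: ennreal_mult')
      finally show ?thesis .
    qed (simp add: F_def G_def mellin_weight_def)
  qed
  also have "\<dots> = (\<integral>\<^sup>+\<tau>. \<integral>\<^sup>+r. ennreal (G r \<tau>) \<partial>lborel \<partial>lborel)"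
    by (rule lborel_pair.Fubini') measurable
  also have "\<dots> = (\<integral>\<^sup>+\<tau>. \<integral>\<^sup>+r. ennreal (mellin_weight s \<tau> * (mellin_weight d r * exp (- (r * (A + \<tau> * y\<^sup>2))))) \<partial>lborel \<partial>lborel)"
  proof (rule nn_integral_cong)
    fix \<tau> :: real
    show "(\<integral>\<^sup>+r. ennreal (G r \<tau>) \<partial>lborel)
      = (\<integral>\<^sup>+r. ennreal (mellin_weight s \<tau> * (mellin_weight d r * exp (- (r * (A + \<tau> * y\<^sup>2))))) \<partial>lborel)"
    proof (cases "0 < \<tau>")
      case True
      have B: "\<tau> * y\<^sup>2 + \<tau> / (1 + \<tau>) * X = \<tau> / (1 + \<tau>) * (A + \<tau> * y\<^sup>2)"
        using True by (simp add: A_def field_simps)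
      have pos: "0 < \<tau> / (1 + \<tau>) * (A + \<tau> * y\<^sup>2)" "0 < A + \<tau> * y\<^sup>2"
        using True A y2 by (auto intro!: mult_pos_pos divide_pos_pos add_pos_pos)
      have "\<tau> powr (d + s - 1) * (1 + \<tau>) powr (- d) * (\<tau> / (1 + \<tau>)) powr (- d) = \<tau> powr (s - 1)"
        using True powr_add[of \<tau> d "s - 1"]
        by (simp add: powr_divide powr_minus field_simps)
      then have "\<tau> powr (d + s - 1) * (1 + \<tau>) powr (- d) * (Gamma d * (\<tau> / (1 + \<tau>) * (A + \<tau> * y\<^sup>2)) powr (- d))
         = \<tau> powr (s - 1) * (Gamma d * (A + \<tau> * y\<^sup>2) powr (- d))"
        using True pos(2) by (subst powr_mult) (auto simp: mult_ac)
      moreover have "(\<integral>\<^sup>+r. ennreal (G r \<tau>) \<partial>lborel) = ennreal (\<tau> powr (d + s - 1) * (1 + \<tau>) powr (- d))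
          * ennreal (Gamma d * (\<tau> / (1 + \<tau>) * (A + \<tau> * y\<^sup>2)) powr (- d))"
        using True assms unfolding G_def B nn_integral_mellin_weight[OF d pos(1), symmetric]
        by (subst nn_integral_cmult[symmetric]) (auto simp: mellin_weight_def[of _ \<tau>] simp flip: ennreal_mult')
      moreover have "(\<integral>\<^sup>+r. ennreal (mellin_weight s \<tau> * (mellin_weight d r * exp (- (r * (A + \<tau> * y\<^sup>2))))) \<partial>lborel)
          = ennreal (\<tau> powr (s - 1)) * ennreal (Gamma d * (A + \<tau> * y\<^sup>2) powr (- d))"
        using True assms unfolding nn_integral_mellin_weight[OF d pos(2), symmetric]
        by (subst nn_integral_cmult[symmetric]) (auto simp: mellin_weight_def[of _ \<tau>] simp flip: ennreal_mult')
      ultimately show ?thesis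
        by (simp only: ennreal_mult'[symmetric] powr_ge_zero mult_nonneg_nonneg)
    qed (simp add: G_def mellin_weight_def)
  qed
  also have "\<dots> = (\<integral>\<^sup>+r. \<integral>\<^sup>+\<tau>. ennreal (mellin_weight s \<tau> * (mellin_weight d r * exp (- (r * (A + \<tau> * y\<^sup>2))))) \<partial>lborel \<partial>lborel)"
    by (rule lborel_pair.Fubini') measurable
  also have "\<dots> = (\<integral>\<^sup>+r. ennreal (Gamma s * (y\<^sup>2) powr (- s)) * ennreal (mellin_weight (d - s) r * exp (- (r * A))) \<partial>lborel)"
  proof (rule nn_integral_cong)
    fix r :: real
    show "(\<integral>\<^sup>+\<tau>. ennreal (mellin_weight s \<tau> * (mellin_weight d r * exp (- (r * (A + \<tau> * y\<^sup>2))))) \<partial>lborel)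
      = ennreal (Gamma s * (y\<^sup>2) powr (- s)) * ennreal (mellin_weight (d - s) r * exp (- (r * A)))"
    proof (cases "0 < r")
      case True
      have e: "mellin_weight s \<tau> * (mellin_weight d r * exp (- (r * (A + \<tau> * y\<^sup>2))))
        = (mellin_weight d r * exp (- (r * A))) * (mellin_weight s \<tau> * exp (- (\<tau> * (r * y\<^sup>2))))" for \<tau>
        by (simp add: algebra_simps mult_exp_exp flip: exp_add)
      have p: "r powr (d - 1) * r powr (- s) = r powr (d - s - 1)"
        by (simp only: powr_add[symmetric]) (simp add: algebra_simps)
      have "(\<integral>\<^sup>+\<tau>. ennreal (mellin_weight s \<tau> * (mellin_weight d r * exp (- (r * (A + \<tau> * y\<^sup>2))))) \<partial>lborel)
         = ennreal (mellin_weight d r * exp (- (r * A))) * ennreal (Gamma s * (r * y\<^sup>2) powr (- s))"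
        unfolding e nn_integral_mellin_weight[OF assms(1) mult_pos_pos[OF True y2], symmetric]
        by (subst nn_integral_cmult[symmetric]) (simp_all flip: ennreal_mult')
      also have "\<dots> = ennreal ((r powr (d - 1) * r powr (- s)) * (Gamma s * (y\<^sup>2) powr (- s)) * exp (- (r * A)))"
        using True y2 by (simp add: mellin_weight_def powr_mult mult_ac flip: ennreal_mult')
      finally show ?thesis
        unfolding p using True Gamma_real_pos[of s] assms by (simp add: mellin_weight_def mult_ac flip: ennreal_mult')
    qed (simp add: mellin_weight_def)
  qed
  also have "\<dots> = ennreal (Gamma s * (y\<^sup>2) powr (- s)) * ennreal (Gamma (d - s) * A powr (- (d - s)))"
    using assms A by (subst nn_integral_cmult) (auto simp: nn_integral_mellin_weight)
  finally show ?thesis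
    using Gamma_real_pos[of s] assms by (simp add: A_def mult_ac flip: ennreal_mult')
qed

text \<open>
  The identity \<open>P |x| powr (- 2 b) = w\<close> combined with \<open>w \<le> |x| powr (- 2 b)\<close>, for \<open>b = d - s\<close>. The comparison
  is made inside the Gaussian mixture, by dropping the factor \<open>exp (- r y\<^sup>2)\<close>, which avoids the
  singularity of \<open>|x| powr (- 2 b)\<close> at the origin.
\<close>

lemma weight_convolution_le:
  fixes x :: "'a::euclidean_space"
  defines "d \<equiv> real DIM('a) / 2"
  assumes "0 < s" "s < d" "0 < y"
  shows "(\<integral>\<^sup>+\<xi>. ennreal (weight (d + s) y (x - \<xi>) * weight (d - s) y \<xi>) \<partial>lborel)
    \<le> ennreal (pi powr d * Gamma s / Gamma (d + s) * (y\<^sup>2) powr (- s) * weight (d - s) y x)"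
proof -
  let ?c = "1 / (Gamma (d + s) * Gamma (d - s))"
  have pos: "0 < Gamma (d + s)" "0 < Gamma (d - s)" "0 < Gamma s"
    using assms by (auto intro!: Gamma_real_pos)
  define H where "H \<xi> r t = mellin_weight (d + s) t * exp (- (t * ((norm (x - \<xi>))\<^sup>2 + y\<^sup>2)))
      * (mellin_weight (d - s) r * exp (- (r * (norm \<xi>)\<^sup>2)))" for \<xi> :: 'a and r t
  have H1 [measurable]: "(\<lambda>(\<xi>, r, t). H \<xi> r t) \<in> borel_measurable (borel \<Otimes>\<^sub>M borel \<Otimes>\<^sub>M borel)"
    unfolding H_def by measurable
  have H2 [measurable]: "(\<lambda>z. H (fst (fst z)) (snd (fst z)) (snd z)) \<in> borel_measurable ((borel \<Otimes>\<^sub>M borel) \<Otimes>\<^sub>M borel)"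
    unfolding H_def by measurable
  have H3 [measurable]: "(\<lambda>(\<xi>, t). H \<xi> r t) \<in> borel_measurable (borel \<Otimes>\<^sub>M borel)" for r
    unfolding H_def by measurable
  have "(\<integral>\<^sup>+\<xi>. ennreal (weight (d + s) y (x - \<xi>) * weight (d - s) y \<xi>) \<partial>lborel)
     \<le> (\<integral>\<^sup>+\<xi>. ennreal ?c * (\<integral>\<^sup>+r. \<integral>\<^sup>+t. ennreal (H \<xi> r t) \<partial>lborel \<partial>lborel) \<partial>lborel)"
  proof (rule nn_integral_mono)
    fix \<xi> :: 'a
    let ?I = "\<integral>\<^sup>+t. ennreal (mellin_weight (d + s) t * exp (- (t * ((norm (x - \<xi>))\<^sup>2 + y\<^sup>2)))) \<partial>lborel"
    have "ennreal (weight (d + s) y (x - \<xi>) * weight (d - s) y \<xi>)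
      = ennreal (1 / Gamma (d + s)) * ?I * (ennreal (1 / Gamma (d - s)) *
          (\<integral>\<^sup>+r. ennreal (mellin_weight (d - s) r * exp (- (r * ((norm \<xi>)\<^sup>2 + y\<^sup>2)))) \<partial>lborel))"
      using assms by (simp add: ennreal_mult' weight_eq_gaussian_mixture)
    also have "\<dots> \<le> ennreal (1 / Gamma (d + s)) * ?I * (ennreal (1 / Gamma (d - s)) *
          (\<integral>\<^sup>+r. ennreal (mellin_weight (d - s) r * exp (- (r * (norm \<xi>)\<^sup>2))) \<partial>lborel))"
      by (intro mult_left_mono nn_integral_mono) (auto simp: mellin_weight_def intro!: ennreal_leI mult_left_mono)
    also have "\<dots> = ennreal ?c * (?I * (\<integral>\<^sup>+r. ennreal (mellin_weight (d - s) r * exp (- (r * (norm \<xi>)\<^sup>2))) \<partial>lborel))"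
    proof -
      have "ennreal ?c = ennreal (1 / Gamma (d + s)) * ennreal (1 / Gamma (d - s))"
        using pos by (simp flip: ennreal_mult')
      then show ?thesis by (simp only: mult_ac)
    qed
    also have "?I * (\<integral>\<^sup>+r. ennreal (mellin_weight (d - s) r * exp (- (r * (norm \<xi>)\<^sup>2))) \<partial>lborel)
        = (\<integral>\<^sup>+r. \<integral>\<^sup>+t. ennreal (H \<xi> r t) \<partial>lborel \<partial>lborel)"
      unfolding H_def by (simp add: ennreal_mult' nn_integral_multc nn_integral_cmult)
    finally show "ennreal (weight (d + s) y (x - \<xi>) * weight (d - s) y \<xi>)
        \<le> ennreal ?c * (\<integral>\<^sup>+r. \<integral>\<^sup>+t. ennreal (H \<xi> r t) \<partial>lborel \<partial>lborel)" .
  qed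
  also have "\<dots> = ennreal ?c * (\<integral>\<^sup>+\<xi>. \<integral>\<^sup>+r. \<integral>\<^sup>+t. ennreal (H \<xi> r t) \<partial>lborel \<partial>lborel \<partial>lborel)"
    by (rule nn_integral_cmult) measurable
  also have "(\<integral>\<^sup>+\<xi>. \<integral>\<^sup>+r. \<integral>\<^sup>+t. ennreal (H \<xi> r t) \<partial>lborel \<partial>lborel \<partial>lborel)
     = (\<integral>\<^sup>+r. \<integral>\<^sup>+\<xi>. \<integral>\<^sup>+t. ennreal (H \<xi> r t) \<partial>lborel \<partial>lborel \<partial>lborel)"
    by (rule lborel_pair.Fubini'[symmetric]) measurable
  also have "\<dots> = (\<integral>\<^sup>+r. \<integral>\<^sup>+t. \<integral>\<^sup>+\<xi>. ennreal (H \<xi> r t) \<partial>lborel \<partial>lborel \<partial>lborel)"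
    by (intro nn_integral_cong lborel_pair.Fubini'[symmetric]) measurable
  also have "\<dots> = (\<integral>\<^sup>+r. \<integral>\<^sup>+t. ennreal (pi powr d) * ennreal (mellin_weight (d + s) t * mellin_weight (d - s) r
        * exp (- (t * y\<^sup>2)) * exp (- (t * r / (t + r) * (norm x)\<^sup>2)) * (t + r) powr (- d)) \<partial>lborel \<partial>lborel)"
  proof (intro nn_integral_cong)
    fix r t :: real
    show "(\<integral>\<^sup>+\<xi>. ennreal (H \<xi> r t) \<partial>lborel) = ennreal (pi powr d) * ennreal (mellin_weight (d + s) t * mellin_weight (d - s) r
        * exp (- (t * y\<^sup>2)) * exp (- (t * r / (t + r) * (norm x)\<^sup>2)) * (t + r) powr (- d))"
    proof (cases "0 < t \<and> 0 < r")
      case True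
      have "H \<xi> r t = mellin_weight (d + s) t * mellin_weight (d - s) r * exp (- (t * y\<^sup>2))
          * exp (- (t * (norm (x - \<xi>))\<^sup>2 + r * (norm \<xi>)\<^sup>2))" for \<xi>
        unfolding H_def by (simp add: algebra_simps mult_exp_exp flip: exp_add)
      then have "(\<integral>\<^sup>+\<xi>. ennreal (H \<xi> r t) \<partial>lborel)
          = ennreal (mellin_weight (d + s) t * mellin_weight (d - s) r * exp (- (t * y\<^sup>2)))
            * ennreal (exp (- (t * r / (t + r) * (norm x)\<^sup>2)) * (pi / (t + r)) powr d)"
        unfolding d_def nn_integral_gaussian_product[OF conjunct1[OF True] conjunct2[OF True], symmetric]
        by (subst nn_integral_cmult[symmetric]) (simp_all flip: ennreal_mult')
      moreover have "(pi / (t + r)) powr d = pi powr d * (t + r) powr (- d)"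
        using True by (simp add: powr_divide powr_minus_divide)
      ultimately show ?thesis
        by (simp add: mult_ac flip: ennreal_mult')
    qed (auto simp: H_def mellin_weight_def)
  qed
  also have "\<dots> = ennreal (pi powr d) * ennreal (Gamma s * Gamma (d - s) * (y\<^sup>2) powr (- s) * ((norm x)\<^sup>2 + y\<^sup>2) powr (- (d - s)))"
    unfolding nn_integral_parallel_mixture[OF assms(2-4) zero_le_power2, symmetric]
    by (simp add: nn_integral_cmult)
  also have "ennreal ?c * \<dots> = ennreal (pi powr d * Gamma s / Gamma (d + s) * (y\<^sup>2) powr (- s) * weight (d - s) y x)"
    using pos by (simp add: weight_def mult_ac flip: ennreal_mult')
  finally show ?thesis .
qed

section \<open>The Poisson average and the upper bound\<close>

definition poisson_kernel :: "real \<Rightarrow> real \<Rightarrow> real ^ 'n::finite \<Rightarrow> real" where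
  "poisson_kernel s y z =
     poisson_const CARD('n) s * (y powr (2 * s) * weight (real CARD('n) / 2 + s) y z)"

text \<open>
  The extension of a nonnegative function. With values in \<^typ>\<open>ennreal\<close> it is defined whether or not
  the integral converges, so Tonelli's theorem and monotonicity apply without side conditions.
\<close>

definition poisson_avg :: "real \<Rightarrow> real \<Rightarrow> (real ^ 'n::finite \<Rightarrow> ennreal) \<Rightarrow> real ^ 'n \<Rightarrow> ennreal" where
  "poisson_avg s y f x = (\<integral>\<^sup>+\<xi>. ennreal (poisson_kernel s y (x - \<xi>)) * f \<xi> \<partial>lborel)"

lemma poisson_const_pos: "0 < s \<Longrightarrow> 0 < poisson_const n s"
  unfolding poisson_const_def
  by (intro divide_pos_pos mult_pos_pos Gamma_real_pos) (auto simp: add_nonneg_pos)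

lemma poisson_kernel_measurable [measurable]: "poisson_kernel s y \<in> borel_measurable borel"
  unfolding poisson_kernel_def by measurable

lemma poisson_kernel_pos: "0 < s \<Longrightarrow> 0 < y \<Longrightarrow> 0 < poisson_kernel s y z"
  by (simp add: poisson_kernel_def poisson_const_pos weight_pos)

lemma poisson_kernel_minus_commute: "poisson_kernel s y (x - \<xi>) = poisson_kernel s y (\<xi> - x)"
  by (simp add: poisson_kernel_def weight_def norm_minus_commute)

lemma poisson_avg_measurable [measurable]:
  assumes [measurable]: "f \<in> borel_measurable borel"
  shows "poisson_avg s y f \<in> borel_measurable borel"
  unfolding poisson_avg_def by measurable

lemma poisson_avg_mono: "(\<And>\<xi>. f \<xi> \<le> g \<xi>) \<Longrightarrow> poisson_avg s y f x \<le> poisson_avg s y g x"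
  unfolding poisson_avg_def by (intro nn_integral_mono mult_left_mono) auto

lemma poisson_avg_cmult:
  assumes [measurable]: "f \<in> borel_measurable borel"
  shows "poisson_avg s y (\<lambda>\<xi>. c * f \<xi>) x = c * poisson_avg s y f x"
proof -
  have "poisson_avg s y (\<lambda>\<xi>. c * f \<xi>) x
    = (\<integral>\<^sup>+\<xi>. c * (ennreal (poisson_kernel s y (x - \<xi>)) * f \<xi>) \<partial>lborel)"
    unfolding poisson_avg_def by (intro nn_integral_cong) (simp add: mult_ac)
  then show ?thesis
    unfolding poisson_avg_def by (subst (asm) nn_integral_cmult) measurable
qed

lemma poisson_avg_add:
  assumes [measurable]: "f \<in> borel_measurable borel" "g \<in> borel_measurable borel"
  shows "poisson_avg s y (\<lambda>\<xi>. f \<xi> + g \<xi>) x = poisson_avg s y f x + poisson_avg s y g x"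
  unfolding poisson_avg_def by (subst nn_integral_add[symmetric]) (auto simp: distrib_left)

text \<open>
  The factor in parentheses is both the total mass of the unnormalised kernel and the constant
  in \<open>weight_convolution_le\<close>.
\<close>

lemma poisson_const_normalises:
  assumes "0 < s" "0 < y"
  shows "poisson_const n s * (y powr (2 * s) *
     (pi powr (real n / 2) * Gamma s / Gamma (real n / 2 + s) * (y\<^sup>2) powr (- s))) = 1"
proof -
  have "0 < Gamma (real n / 2 + s)" "0 < Gamma s"
    using assms by (auto intro!: Gamma_real_pos add_nonneg_pos)
  moreover have "(real n + 2 * s) / 2 = real n / 2 + s" by simp
  moreover have "(y\<^sup>2) powr (- s) * y powr (2 * s) = 1"
    using assms by (simp add: powr_powr powr_minus field_simps flip: powr_numeral)
  ultimately show ?thesis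
    by (simp add: poisson_const_def field_simps)
qed

lemma poisson_avg_1:
  assumes "0 < s" "0 < y"
  shows "poisson_avg s y (\<lambda>_. 1) (x :: real ^ 'n::finite) = 1"
proof -
  have "poisson_avg s y (\<lambda>_. 1) x = (\<integral>\<^sup>+\<xi>. ennreal (poisson_kernel s y (\<xi> - x)) \<partial>lborel)"
    unfolding poisson_avg_def by (simp add: poisson_kernel_minus_commute[of s y x])
  also have "\<dots> = (\<integral>\<^sup>+(\<xi>::real^'n). ennreal (poisson_kernel s y \<xi>) \<partial>lborel)"
    by (rule nn_integral_translate) measurable
  also have "\<dots> = ennreal (poisson_const CARD('n) s * y powr (2 * s)) * (\<integral>\<^sup>+(\<xi>::real^'n). ennreal (weight (real CARD('n) / 2 + s) y \<xi>) \<partial>lborel)"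
    using poisson_const_pos[OF assms(1)] unfolding poisson_kernel_def
    by (subst nn_integral_cmult[symmetric]) (auto simp: mult_ac less_imp_le simp flip: ennreal_mult')
  also have "\<dots> = ennreal (poisson_const CARD('n) s * (y powr (2 * s) *
     (pi powr (real CARD('n) / 2) * Gamma s / Gamma (real CARD('n) / 2 + s) * (y\<^sup>2) powr (- s))))"
    using assms poisson_const_pos[OF assms(1)]
    by (simp add: nn_integral_weight mult.assoc less_imp_le flip: ennreal_mult')
  finally show ?thesis
    by (simp only: poisson_const_normalises[OF assms] ennreal_1)
qed

lemma poisson_avg_weight_extremal:
  fixes x :: "real ^ 'n::finite"
  assumes "0 < s" "s < real CARD('n) / 2" "0 < y"
  shows "poisson_avg s y (\<lambda>\<xi>. ennreal (weight (real CARD('n) / 2 - s) y \<xi>)) x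
    \<le> ennreal (weight (real CARD('n) / 2 - s) y x)"
proof -
  let ?d = "real CARD('n) / 2"
  have c: "0 \<le> poisson_const CARD('n) s * y powr (2 * s)"
    using poisson_const_pos[OF assms(1)] by (simp add: less_imp_le)
  have "poisson_avg s y (\<lambda>\<xi>. ennreal (weight (?d - s) y \<xi>)) x
    = ennreal (poisson_const CARD('n) s * y powr (2 * s)) *
      (\<integral>\<^sup>+\<xi>. ennreal (weight (?d + s) y (x - \<xi>) * weight (?d - s) y \<xi>) \<partial>lborel)"
    using c unfolding poisson_avg_def poisson_kernel_def
    by (subst nn_integral_cmult[symmetric]) (auto simp: mult_ac simp flip: ennreal_mult')
  also have "\<dots> \<le> ennreal (poisson_const CARD('n) s * y powr (2 * s)) *
     ennreal (pi powr ?d * Gamma s / Gamma (?d + s) * (y\<^sup>2) powr (- s) * weight (?d - s) y x)"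
    using weight_convolution_le[of s y x] assms by (intro mult_left_mono) auto
  also have "\<dots> = ennreal ((poisson_const CARD('n) s * (y powr (2 * s) *
      (pi powr ?d * Gamma s / Gamma (?d + s) * (y\<^sup>2) powr (- s)))) * weight (?d - s) y x)"
    using c by (simp add: mult.assoc flip: ennreal_mult')
  finally show ?thesis
    using assms by (simp only: poisson_const_normalises mult_1)
qed

text \<open>
  With \<open>b = n/2 - s\<close> and \<open>\<theta> = \<alpha>/b\<close>, Young's inequality bounds
  \<open>w\<^sub>b(\<xi>) powr \<theta> * w\<^sub>b(x) powr (1 - \<theta>)\<close> by an affine function of \<open>w\<^sub>b(\<xi>)\<close>; averaging over \<open>\<xi>\<close> reduces
  the claim to the extremal exponent.
\<close>

lemma poisson_avg_weight_le:
  fixes x :: "real ^ 'n::finite"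
  assumes "0 < s" "0 < y" "0 \<le> \<alpha>" "\<alpha> \<le> real CARD('n) / 2 - s"
  shows "poisson_avg s y (\<lambda>\<xi>. ennreal (weight \<alpha> y \<xi>)) x \<le> ennreal (weight \<alpha> y x)"
proof (cases "\<alpha> = 0")
  case True
  have "weight 0 y \<xi> = 1" for \<xi> :: "real ^ 'n"
    using assms(2) by (simp add: weight_def)
  then show ?thesis
    using True assms by (simp add: poisson_avg_1)
next
  case False
  define b where "b = real CARD('n) / 2 - s"
  define \<theta> where "\<theta> = \<alpha> / b"
  have b: "0 < b" "s < real CARD('n) / 2" using assms False by (auto simp: b_def)
  have \<theta>: "0 < \<theta>" "\<theta> \<le> 1" using assms False b by (auto simp: \<theta>_def b_def)
  have w\<theta>: "weight \<alpha> y \<xi> = weight b y \<xi> powr \<theta>" for \<xi> :: "real ^ 'n"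
    using b by (simp add: weight_def powr_powr \<theta>_def)
  let ?W = "weight b y x"
  have W: "0 < ?W" by (rule weight_pos) fact
  have "ennreal (?W powr (1 - \<theta>)) * poisson_avg s y (\<lambda>\<xi>. ennreal (weight \<alpha> y \<xi>)) x
     = poisson_avg s y (\<lambda>\<xi>. ennreal (?W powr (1 - \<theta>)) * ennreal (weight \<alpha> y \<xi>)) x"
    by (rule poisson_avg_cmult[symmetric]) measurable
  also have "\<dots> \<le> poisson_avg s y (\<lambda>\<xi>. ennreal \<theta> * ennreal (weight b y \<xi>) + ennreal ((1 - \<theta>) * ?W) * 1) x"
  proof (rule poisson_avg_mono)
    fix \<xi> :: "real ^ 'n"
    have "weight b y \<xi> powr \<theta> * ?W powr (1 - \<theta>) \<le> \<theta> * weight b y \<xi> + (1 - \<theta>) * ?W"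
      using \<theta> W weight_pos[OF assms(2)] by (intro Youngs_inequality_0) auto
    then show "ennreal (?W powr (1 - \<theta>)) * ennreal (weight \<alpha> y \<xi>)
      \<le> ennreal \<theta> * ennreal (weight b y \<xi>) + ennreal ((1 - \<theta>) * ?W) * 1"
      using \<theta> W by (simp add: w\<theta> mult.commute flip: ennreal_mult' ennreal_plus)
  qed
  also have "\<dots> = ennreal \<theta> * poisson_avg s y (\<lambda>\<xi>. ennreal (weight b y \<xi>)) x
      + ennreal ((1 - \<theta>) * ?W) * poisson_avg s y (\<lambda>_. 1) x"
    using poisson_avg_cmult[of "\<lambda>\<xi>. ennreal (weight b y \<xi>)" s y "ennreal \<theta>" x]
      poisson_avg_cmult[of "\<lambda>_. 1" s y "ennreal ((1 - \<theta>) * ?W)" x]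
    by (subst poisson_avg_add) auto
  also have "\<dots> \<le> ennreal \<theta> * ennreal ?W + ennreal ((1 - \<theta>) * ?W) * 1"
    using poisson_avg_weight_extremal[OF assms(1) b(2) assms(2), of x] assms
    by (intro add_mono mult_left_mono) (auto simp: poisson_avg_1 b_def)
  also have "\<dots> = ennreal ?W"
    using \<theta> W by (simp add: algebra_simps flip: ennreal_mult' ennreal_plus)
  finally have "ennreal (?W powr (\<theta> - 1)) * (ennreal (?W powr (1 - \<theta>)) * poisson_avg s y (\<lambda>\<xi>. ennreal (weight \<alpha> y \<xi>)) x)
      \<le> ennreal (?W powr (\<theta> - 1)) * ennreal ?W"
    by (rule mult_left_mono) simp
  moreover have "?W powr (\<theta> - 1) * ?W = weight \<alpha> y x" "?W powr (\<theta> - 1) * ?W powr (1 - \<theta>) = 1"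
    using W powr_add[of ?W "\<theta> - 1" 1] powr_add[of ?W "\<theta> - 1" "1 - \<theta>"] by (simp_all add: w\<theta>)
  ultimately show ?thesis
    by (simp add: mult.assoc[symmetric] flip: ennreal_mult')
qed

lemma poisson_avg_self_adjoint:
  fixes f g :: "real ^ 'n::finite \<Rightarrow> ennreal"
  assumes [measurable]: "f \<in> borel_measurable borel" "g \<in> borel_measurable borel"
  shows "(\<integral>\<^sup>+x. poisson_avg s y f x * g x \<partial>lborel) = (\<integral>\<^sup>+x. f x * poisson_avg s y g x \<partial>lborel)"
proof -
  have "(\<integral>\<^sup>+x. poisson_avg s y f x * g x \<partial>lborel)
    = (\<integral>\<^sup>+x. \<integral>\<^sup>+\<xi>. ennreal (poisson_kernel s y (x - \<xi>)) * f \<xi> * g x \<partial>lborel \<partial>lborel)"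
    unfolding poisson_avg_def by (subst nn_integral_multc) auto
  also have "\<dots> = (\<integral>\<^sup>+\<xi>. \<integral>\<^sup>+x. ennreal (poisson_kernel s y (x - \<xi>)) * f \<xi> * g x \<partial>lborel \<partial>lborel)"
    by (rule lborel_pair.Fubini'[symmetric]) measurable
  also have "\<dots> = (\<integral>\<^sup>+\<xi>. \<integral>\<^sup>+x. f \<xi> * (ennreal (poisson_kernel s y (\<xi> - x)) * g x) \<partial>lborel \<partial>lborel)"
  proof (intro nn_integral_cong)
    fix \<xi> x :: "real ^ 'n"
    show "ennreal (poisson_kernel s y (x - \<xi>)) * f \<xi> * g x = f \<xi> * (ennreal (poisson_kernel s y (\<xi> - x)) * g x)"
      by (subst poisson_kernel_minus_commute) (simp add: mult_ac)
  qed
  also have "\<dots> = (\<integral>\<^sup>+\<xi>. f \<xi> * poisson_avg s y g \<xi> \<partial>lborel)"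
    unfolding poisson_avg_def by (subst nn_integral_cmult) auto
  finally show ?thesis .
qed

text \<open>
  The graph of \<open>v \<mapsto> v powr p\<close> lies above its tangent at \<open>m\<close>.
\<close>

lemma powr_tangent:
  fixes v m p :: real
  assumes "0 \<le> v" "0 < m" "1 \<le> p"
  shows "p * m powr (p - 1) * v \<le> v powr p + (p - 1) * m powr p"
proof (cases "v = 0")
  case False
  have "(v powr p) powr (1 / p) * (m powr p) powr (1 - 1 / p) \<le> 1 / p * v powr p + (1 - 1 / p) * m powr p"
    using assms False by (intro Youngs_inequality_0) auto
  then have "p * (v * m powr (p - 1)) \<le> p * (1 / p * v powr p + (1 - 1 / p) * m powr p)"
    using assms False by (intro mult_left_mono) (auto simp: powr_powr right_diff_distrib)
  also have "p * (1 / p * v powr p + (1 - 1 / p) * m powr p) = v powr p + (p - 1) * m powr p"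
    using assms by (simp add: distrib_left left_diff_distrib right_diff_distrib)
  finally show ?thesis
    by (simp add: mult_ac)
qed (use assms in auto)

text \<open>
  Integrate the tangent inequality at \<open>m = expectation v\<close>. The case \<open>m = 0\<close> is separate because the
  tangent bound needs \<open>0 < m\<close>; there the left-hand side is 0.
\<close>

lemma (in prob_space) powr_jensen:
  fixes v :: "'a \<Rightarrow> real"
  assumes [measurable]: "v \<in> borel_measurable M"
    and "\<And>x. 0 \<le> v x" "1 \<le> p" "integrable M (\<lambda>x. v x powr p)"
  shows "integrable M v" "expectation v powr p \<le> expectation (\<lambda>x. v x powr p)"
proof -
  have "v x \<le> 1 + v x powr p" for x
    using powr_tangent[of "v x" 1 p] assms(2)[of x] assms(3) mult_right_mono[of 1 p "v x"]
      powr_mono[of 1 p "v x"] by (cases "v x \<le> 1") (auto simp: add_increasing2)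
  then show int: "integrable M v"
    using assms by (intro Bochner_Integration.integrable_bound[of M "\<lambda>x. 1 + v x powr p" v]) auto
  define m where "m = expectation v"
  have "0 \<le> m" using assms by (simp add: m_def)
  show "expectation v powr p \<le> expectation (\<lambda>x. v x powr p)"
  proof (cases "m = 0")
    case False
    with \<open>0 \<le> m\<close> have m: "0 < m" by simp
    have "expectation (\<lambda>x. p * m powr (p - 1) * v x) \<le> expectation (\<lambda>x. v x powr p + (p - 1) * m powr p)"
      using int assms m by (intro integral_mono) (auto intro!: powr_tangent)
    also have "expectation (\<lambda>x. p * m powr (p - 1) * v x) = p * (m powr (p - 1) * m)"
      by (simp add: m_def mult.assoc)
    also have "m powr (p - 1) * m = m powr p"
      using m powr_add[of m "p - 1" 1] by simp
    also have "expectation (\<lambda>x. v x powr p + (p - 1) * m powr p) = expectation (\<lambda>x. v x powr p) + (p - 1) * m powr p"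
      using assms by (simp add: prob_space)
    finally show ?thesis by (simp add: m_def algebra_simps)
  qed (use assms in \<open>simp add: m_def\<close>)
qed

lemma poisson_avg_powr_jensen:
  fixes v :: "real ^ 'n::finite \<Rightarrow> real"
  assumes [measurable]: "v \<in> borel_measurable borel"
    and "0 < s" "0 < y" "\<And>\<xi>. 0 \<le> v \<xi>" "1 \<le> p"
    and fin: "poisson_avg s y (\<lambda>\<xi>. ennreal (v \<xi> powr p)) x < \<infinity>"
  shows "integrable lborel (\<lambda>\<xi>. poisson_kernel s y (x - \<xi>) * v \<xi>)"
    and "ennreal ((\<integral>\<xi>. poisson_kernel s y (x - \<xi>) * v \<xi> \<partial>lborel) powr p)
      \<le> poisson_avg s y (\<lambda>\<xi>. ennreal (v \<xi> powr p)) x"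
proof -
  let ?k = "\<lambda>\<xi>. poisson_kernel s y (x - \<xi>)"
  let ?M = "density lborel ?k"
  have k: "0 \<le> ?k \<xi>" for \<xi> using assms by (simp add: poisson_kernel_pos less_imp_le)
  interpret P: prob_space ?M
    using poisson_avg_1[OF assms(2,3), of x]
    by (intro prob_spaceI) (simp add: emeasure_density poisson_avg_def)
  have nn: "(\<integral>\<^sup>+\<xi>. ennreal (v \<xi> powr p) \<partial>?M) = poisson_avg s y (\<lambda>\<xi>. ennreal (v \<xi> powr p)) x"
    unfolding poisson_avg_def by (subst nn_integral_density) auto
  have int: "integrable ?M (\<lambda>\<xi>. v \<xi> powr p)"
    using fin nn by (intro integrableI_nonneg) auto
  have v: "integrable ?M v" "P.expectation v powr p \<le> P.expectation (\<lambda>\<xi>. v \<xi> powr p)"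
    using P.powr_jensen[OF _ assms(4,5) int] by simp_all
  show "integrable lborel (\<lambda>\<xi>. ?k \<xi> * v \<xi>)"
    using v(1) k by (subst (asm) integrable_density) auto
  have E1: "P.expectation v = (\<integral>\<xi>. ?k \<xi> * v \<xi> \<partial>lborel)"
    using k by (subst integral_density) auto
  have E2: "ennreal (P.expectation (\<lambda>\<xi>. v \<xi> powr p)) = poisson_avg s y (\<lambda>\<xi>. ennreal (v \<xi> powr p)) x"
    using int nn by (subst nn_integral_eq_integral[symmetric]) auto
  show "ennreal ((\<integral>\<xi>. ?k \<xi> * v \<xi> \<partial>lborel) powr p)
      \<le> poisson_avg s y (\<lambda>\<xi>. ennreal (v \<xi> powr p)) x"
    unfolding E1[symmetric] E2[symmetric] by (rule ennreal_leI[OF v(2)])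
qed

lemma poisson_const_ext_integrand:
  fixes x \<xi> :: "real ^ 'n::finite"
  shows "poisson_const CARD('n) s * ext_integrand s u x y \<xi> = poisson_kernel s y (x - \<xi>) * u \<xi>"
proof -
  have e: "(real CARD('n) + 2 * s) / 2 = real CARD('n) / 2 + s" by simp
  show ?thesis
    unfolding ext_integrand_def poisson_kernel_def weight_def e powr_minus_divide by simp
qed

lemma integrable_ext_integrand_iff:
  fixes x :: "real ^ 'n::finite"
  assumes "0 < s"
  shows "integrable lebesgue (ext_integrand s u x y)
    \<longleftrightarrow> integrable lebesgue (\<lambda>\<xi>. poisson_kernel s y (x - \<xi>) * u \<xi>)"
  unfolding poisson_const_ext_integrand[symmetric]
  using poisson_const_pos[OF assms, of "CARD('n)"] by simp

lemma harmonic_ext_eq: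
  "harmonic_ext s u x y = (\<integral>\<xi>. poisson_kernel s y (x - \<xi>) * u \<xi> \<partial>lebesgue)"
  unfolding harmonic_ext_def poisson_const_ext_integrand[symmetric] by simp

lemma weighted_integral_eq:
  "weighted_integral \<alpha> p y f = (\<integral>\<^sup>+x. ennreal (\<bar>f x\<bar> powr p * weight \<alpha> y x) \<partial>lborel)"
  unfolding weighted_integral_def weight_def by (simp add: nn_integral_completion powr_minus_divide)

text \<open>
  The chain \<open>\<integral> |P u|\<^sup>p w \<le> \<integral> P(|u|\<^sup>p) w = \<integral> |u|\<^sup>p P w \<le> \<integral> |u|\<^sup>p w\<close>. Finiteness of its last member makes
  \<open>P(|u|\<^sup>p)\<close> finite almost everywhere, and this is what makes the integral defining \<open>P u\<close> converge.
\<close>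

theorem admissible_const_1:
  assumes "0 < s" "0 \<le> \<alpha>" "\<alpha> \<le> real CARD('n::finite) / 2 - s" "1 \<le> p"
  shows "admissible_const TYPE('n) s \<alpha> p 1"
  unfolding admissible_const_def
proof (intro conjI allI impI)
  fix y :: real and u :: "real ^ 'n \<Rightarrow> real"
  assume y: "0 < y" and u: "u \<in> borel_measurable lebesgue" and fin: "weighted_integral \<alpha> p y u < \<infinity>"
  \<comment> \<open>Tonelli's theorem needs a Borel function, and \<open>u\<close> is only Lebesgue measurable.\<close>
  obtain v where v [measurable]: "v \<in> borel_measurable borel" and ae: "AE \<xi> in lborel. u \<xi> = v \<xi>"
    using completion_ex_borel_measurable_real[OF u] by auto
  let ?A = "poisson_avg s y (\<lambda>\<xi>. ennreal (\<bar>v \<xi>\<bar> powr p))"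
  have "(\<integral>\<^sup>+x. ?A x * ennreal (weight \<alpha> y x) \<partial>lborel)
     = (\<integral>\<^sup>+x. ennreal (\<bar>v x\<bar> powr p) * poisson_avg s y (\<lambda>\<xi>. ennreal (weight \<alpha> y \<xi>)) x \<partial>lborel)"
    by (rule poisson_avg_self_adjoint) measurable
  also have "\<dots> \<le> (\<integral>\<^sup>+x. ennreal (\<bar>v x\<bar> powr p) * ennreal (weight \<alpha> y x) \<partial>lborel)"
    using assms y by (intro nn_integral_mono mult_left_mono poisson_avg_weight_le) auto
  also have "\<dots> = weighted_integral \<alpha> p y u"
    unfolding weighted_integral_eq using ae
    by (intro nn_integral_cong_AE) (auto elim!: eventually_mono simp: ennreal_mult')
  finally have le: "(\<integral>\<^sup>+x. ?A x * ennreal (weight \<alpha> y x) \<partial>lborel) \<le> weighted_integral \<alpha> p y u" .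
  with fin have "AE x in lborel. ?A x * ennreal (weight \<alpha> y x) \<noteq> \<infinity>"
    by (intro nn_integral_PInf_AE) auto
  then have A: "AE x in lborel. ?A x < \<infinity>"
  proof eventually_elim
    case (elim x)
    moreover have "ennreal (weight \<alpha> y x) \<noteq> 0"
      using weight_pos[OF y, of \<alpha> x] by simp
    ultimately show ?case
      by (metis ennreal_mult_eq_top_iff infinity_ennreal_def less_top)
  qed
  have main: "integrable lebesgue (ext_integrand s u x y) \<and> ennreal (\<bar>harmonic_ext s u x y\<bar> powr p) \<le> ?A x"
    if x: "?A x < \<infinity>" for x
  proof
    let ?k = "\<lambda>\<xi>. poisson_kernel s y (x - \<xi>)"
    have k: "0 \<le> ?k \<xi>" for \<xi> using assms y by (simp add: poisson_kernel_pos less_imp_le)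
    have J: "integrable lborel (\<lambda>\<xi>. ?k \<xi> * \<bar>v \<xi>\<bar>)"
        "ennreal ((\<integral>\<xi>. ?k \<xi> * \<bar>v \<xi>\<bar> \<partial>lborel) powr p) \<le> ?A x"
      using poisson_avg_powr_jensen[of "\<lambda>\<xi>. \<bar>v \<xi>\<bar>" s y p x] x assms y by auto
    have vint: "integrable lborel (\<lambda>\<xi>. ?k \<xi> * v \<xi>)"
      using J(1) by (rule Bochner_Integration.integrable_bound) (auto simp: abs_mult k)
    have ae': "AE \<xi> in lebesgue. ?k \<xi> * v \<xi> = ?k \<xi> * u \<xi>"
      using AE_completion[OF ae] by eventually_elim simp
    have meas: "?k \<in> borel_measurable lebesgue" "(\<lambda>\<xi>. ?k \<xi> * v \<xi>) \<in> borel_measurable lebesgue"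
      by (auto intro!: measurable_completion)
    show "integrable lebesgue (ext_integrand s u x y)"
      unfolding integrable_ext_integrand_iff[OF assms(1)]
      by (rule integrable_cong_AE_imp[OF _ _ ae'])
         (use vint meas u in \<open>auto simp: integrable_completion\<close>)
    have "harmonic_ext s u x y = (\<integral>\<xi>. ?k \<xi> * v \<xi> \<partial>lebesgue)"
      unfolding harmonic_ext_eq using meas u ae' by (intro integral_cong_AE) (auto elim!: eventually_mono)
    also have "\<dots> = (\<integral>\<xi>. ?k \<xi> * v \<xi> \<partial>lborel)"
      by (rule integral_completion) measurable
    finally have "\<bar>harmonic_ext s u x y\<bar> \<le> (\<integral>\<xi>. ?k \<xi> * \<bar>v \<xi>\<bar> \<partial>lborel)"
      using integral_abs_bound[of lborel "\<lambda>\<xi>. ?k \<xi> * v \<xi>"] by (simp add: abs_mult k)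
    then have "ennreal (\<bar>harmonic_ext s u x y\<bar> powr p) \<le> ennreal ((\<integral>\<xi>. ?k \<xi> * \<bar>v \<xi>\<bar> \<partial>lborel) powr p)"
      using assms by (intro ennreal_leI powr_mono2) auto
    with J(2) show "ennreal (\<bar>harmonic_ext s u x y\<bar> powr p) \<le> ?A x"
      by (rule order_trans[rotated])
  qed
  show "AE x in lebesgue. integrable lebesgue (ext_integrand s u x y)"
    using AE_completion[OF A] by eventually_elim (use main in blast)
  have "weighted_integral \<alpha> p y (\<lambda>x. harmonic_ext s u x y) \<le> (\<integral>\<^sup>+x. ?A x * ennreal (weight \<alpha> y x) \<partial>lborel)"
    unfolding weighted_integral_eq using A
    by (intro nn_integral_mono_AE) (auto elim!: eventually_mono simp: ennreal_mult' intro!: mult_right_mono main[THEN conjunct2])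
  also note le
  finally show "weighted_integral \<alpha> p y (\<lambda>x. harmonic_ext s u x y) \<le> ennreal 1 * weighted_integral \<alpha> p y u"
    by simp
qed simp

section \<open>No admissible constant below 1\<close>

declare borel_open[OF open_ball, measurable]

text \<open>
  Test functions are indicators throughout; for them the Bochner integral and the
  nonnegative average agree.
\<close>

lemma harmonic_ext_indicator:
  fixes A :: "(real ^ 'n::finite) set"
  assumes "0 < s" "0 < y" and [measurable]: "A \<in> sets borel"
  shows "ennreal (harmonic_ext s (indicator A) x y) = poisson_avg s y (indicator A) x"
    and "0 \<le> harmonic_ext s (indicator A) x y" "harmonic_ext s (indicator A) x y \<le> 1"
proof -
  let ?f = "\<lambda>\<xi>. poisson_kernel s y (x - \<xi>) * indicator A \<xi>"
  have nn: "0 \<le> ?f \<xi>" for \<xi> using assms by (simp add: poisson_kernel_pos less_imp_le)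
  have avg: "poisson_avg s y (indicator A) x = (\<integral>\<^sup>+\<xi>. ennreal (?f \<xi>) \<partial>lborel)"
    unfolding poisson_avg_def by (intro nn_integral_cong) (auto simp: indicator_def)
  have le1: "poisson_avg s y (indicator A) x \<le> 1"
    using poisson_avg_mono[of "indicator A" "\<lambda>_. 1" s y x] assms
    by (simp add: poisson_avg_1 indicator_def)
  have int: "integrable lborel ?f"
    using nn avg le1 by (intro integrableI_nonneg) (auto intro: le_less_trans)
  have h: "harmonic_ext s (indicator A) x y = (\<integral>\<xi>. ?f \<xi> \<partial>lborel)"
    unfolding harmonic_ext_eq by (rule integral_completion) measurable
  show eq: "ennreal (harmonic_ext s (indicator A) x y) = poisson_avg s y (indicator A) x"
    unfolding h avg using int nn by (intro nn_integral_eq_integral[symmetric]) auto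
  show "0 \<le> harmonic_ext s (indicator A) x y"
    unfolding h using nn by (intro integral_nonneg_AE) auto
  show "harmonic_ext s (indicator A) x y \<le> 1"
    using le1 unfolding eq[symmetric] by simp
qed

text \<open>
  Since \<open>0 powr p = 0\<close> and \<open>1 powr p = 1\<close>, the right-hand side of the inequality does not depend on \<open>p\<close>
  for an indicator.
\<close>

lemma weighted_integral_indicator:
  fixes A :: "(real ^ 'n::finite) set"
  shows "weighted_integral \<alpha> p y (indicator A :: _ \<Rightarrow> real)
    = (\<integral>\<^sup>+x. indicator A x * ennreal (weight \<alpha> y x) \<partial>lborel)"
  unfolding weighted_integral_eq by (intro nn_integral_cong) (auto simp: indicator_def)

lemma weight_ge:
  assumes "norm x \<le> r" "0 \<le> \<alpha>" "0 < y"
  shows "(r\<^sup>2 + y\<^sup>2) powr (- \<alpha>) \<le> weight \<alpha> y x"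
  unfolding weight_def using assms norm_sq_plus_pos[of y x]
  by (intro powr_mono2') (auto intro!: power_mono add_right_mono)

lemma weight_1_le_1: "0 \<le> \<alpha> \<Longrightarrow> weight \<alpha> 1 x \<le> 1"
  unfolding weight_def using powr_mono2'[of "- \<alpha>" 1 "(norm x)\<^sup>2 + 1"] by simp

text \<open>
  \<open>M\<close> is a radius such that the kernel has mass more than \<open>c\<close> on the ball of radius \<open>M\<close>. Around a
  point of \<open>ball 0 R\<close> that ball stays inside \<open>ball 0 (R + M)\<close>.
\<close>

lemma poisson_mass_concentrates:
  assumes "0 < s" "0 < y" "c < 1"
  shows "\<exists>M>0. \<forall>R. \<forall>(x::real^'n::finite)\<in>ball 0 R.
    ennreal c \<le> poisson_avg s y (indicator (ball 0 (R + M))) x"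
proof -
  let ?N = "density lborel (poisson_kernel s y :: real ^ 'n \<Rightarrow> real)"
  let ?B = "\<lambda>k. ball (0 :: real ^ 'n) (real k)"
  have N: "emeasure ?N A = (\<integral>\<^sup>+\<xi>. ennreal (poisson_kernel s y \<xi>) * indicator A \<xi> \<partial>lborel)"
    if "A \<in> sets borel" for A using that by (simp add: emeasure_density)
  have "(\<Union>k. ?B k) = UNIV"
    using reals_Archimedean2 by (auto simp: mem_ball)
  moreover have "emeasure ?N UNIV = 1"
    using poisson_avg_1[OF assms(1,2), of "0 :: real ^ 'n"]
    by (simp add: N poisson_avg_def poisson_kernel_minus_commute[of s y 0, simplified])
  moreover have "(\<lambda>k. emeasure ?N (?B k)) \<longlonglongrightarrow> emeasure ?N (\<Union>k. ?B k)"
    by (intro Lim_emeasure_incseq) (auto simp: incseq_def)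
  ultimately have "(\<lambda>k. emeasure ?N (?B k)) \<longlonglongrightarrow> 1" by simp
  moreover have "ennreal c < 1"
    using assms(3) by simp
  ultimately have "eventually (\<lambda>k. ennreal c < emeasure ?N (?B k)) sequentially"
    by (rule order_tendstoD)
  then have "eventually (\<lambda>k. ennreal c < emeasure ?N (?B k) \<and> 0 < k) sequentially"
    using eventually_gt_at_top by (rule eventually_conj)
  then obtain k where k: "ennreal c < emeasure ?N (?B k)" "0 < k"
    by (auto simp: eventually_sequentially)
  show ?thesis
  proof (intro exI conjI allI ballI)
    show "0 < real k" using k by simp
    fix R and x :: "real ^ 'n" assume x: "x \<in> ball 0 R"
    have "emeasure ?N (?B k) = (\<integral>\<^sup>+\<xi>. ennreal (poisson_kernel s y (\<xi> - x)) * indicator (?B k) (\<xi> - x) \<partial>lborel)"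
      unfolding N[OF borel_open[OF open_ball]] by (rule nn_integral_translate[symmetric]) measurable
    also have "\<dots> \<le> poisson_avg s y (indicator (ball 0 (R + real k))) x"
      unfolding poisson_avg_def poisson_kernel_minus_commute[of s y x]
    proof (intro nn_integral_mono mult_left_mono)
      fix \<xi>
      have "norm \<xi> \<le> norm (\<xi> - x) + norm x"
        using norm_triangle_ineq[of "\<xi> - x" x] by simp
      then show "indicator (?B k) (\<xi> - x) \<le> (indicator (ball 0 (R + real k)) \<xi> :: ennreal)"
        using x by (auto simp: indicator_def)
    qed simp
    finally show "ennreal c \<le> poisson_avg s y (indicator (ball 0 (R + real k))) x"
      using k(1) by simp
  qed
qed

text \<open>
  Testing an admissible \<open>C < 1\<close> with indicators of balls gives \<open>J r \<le> q J (r + M)\<close> with \<open>q < 1\<close> for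
  the weighted volume \<open>J\<close>. Iterating this contradicts \<open>J r = O(r\<^sup>n)\<close>.
\<close>

theorem admissible_const_ge_1:
  assumes "0 < s" "0 \<le> \<alpha>" "1 \<le> p" and adm: "admissible_const TYPE('n::finite) s \<alpha> p C"
  shows "1 \<le> C"
proof (rule ccontr)
  assume "\<not> 1 \<le> C"
  moreover have "0 < C" using adm by (simp add: admissible_const_def)
  ultimately have C: "0 < C" "C < 1" by auto
  \<comment> \<open>The extension need only be so close to 1 that its \<open>p\<close>-th power still exceeds \<open>C\<close>.\<close>
  define g where "g = (C + 1) / 2"
  define q where "q = C / g"
  have g: "0 < g" "g < 1" "C < g" using C by (auto simp: g_def)
  have q: "0 < q" "q < 1" using C g by (auto simp: q_def)
  have "g powr (1 / p) < 1 powr (1 / p)"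
    using g assms by (intro powr_less_mono2) auto
  then obtain M where M: "0 < M" and mass: "\<And>R. \<forall>(x::real^'n)\<in>ball 0 R.
    ennreal (g powr (1 / p)) \<le> poisson_avg s 1 (indicator (ball 0 (R + M))) x"
    using poisson_mass_concentrates[of s 1 "g powr (1 / p)"] assms by auto
  define J where "J r = (\<integral>\<^sup>+(x::real^'n). indicator (ball 0 r) x * ennreal (weight \<alpha> 1 x) \<partial>lborel)" for r
  let ?n = "CARD('n)"
  let ?V = "unit_ball_vol (real ?n)"
  have J_le: "J r \<le> ennreal (?V * r ^ ?n)" if "0 \<le> r" for r
  proof -
    have "J r \<le> (\<integral>\<^sup>+(x::real^'n). indicator (ball 0 r) x \<partial>lborel)"
      unfolding J_def using weight_1_le_1[OF assms(2)]
      by (intro nn_integral_mono) (auto simp: indicator_def)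
    also have "\<dots> = ennreal (?V * r ^ ?n)"
      using that by (simp add: emeasure_ball)
    finally show ?thesis .
  qed
  have J_pos: "0 < J M"
  proof -
    have "0 < ennreal ((M\<^sup>2 + 1) powr (- \<alpha>)) * ennreal (?V * M ^ ?n)"
      using M by (simp add: add_nonneg_pos less_imp_neq[symmetric] flip: ennreal_mult')
    also have "\<dots> = (\<integral>\<^sup>+(x::real^'n). ennreal ((M\<^sup>2 + 1) powr (- \<alpha>)) * indicator (ball 0 M) x \<partial>lborel)"
      using M by (subst nn_integral_cmult) (auto simp: emeasure_ball)
    also have "\<dots> \<le> J M"
      unfolding J_def using weight_ge[of "_ :: real ^ 'n" M \<alpha> 1] assms
      by (intro nn_integral_mono) (auto simp: indicator_def less_imp_le intro!: ennreal_leI)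
    finally show ?thesis .
  qed
  have step: "J r \<le> ennreal q * J (r + M)" if "0 \<le> r" for r
  proof -
    let ?u = "indicator (ball 0 (r + M)) :: real ^ 'n \<Rightarrow> real"
    have wi: "weighted_integral \<alpha> p 1 ?u = J (r + M)"
      unfolding J_def by (rule weighted_integral_indicator)
    have "ennreal g * J r = (\<integral>\<^sup>+(x::real^'n). ennreal g * (indicator (ball 0 r) x * ennreal (weight \<alpha> 1 x)) \<partial>lborel)"
      unfolding J_def by (rule nn_integral_cmult[symmetric]) measurable
    also have "\<dots> \<le> weighted_integral \<alpha> p 1 (\<lambda>x. harmonic_ext s ?u x 1)"
      unfolding weighted_integral_eq
    proof (rule nn_integral_mono)
      fix x :: "real ^ 'n"
      show "ennreal g * (indicator (ball 0 r) x * ennreal (weight \<alpha> 1 x))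
        \<le> ennreal (\<bar>harmonic_ext s ?u x 1\<bar> powr p * weight \<alpha> 1 x)"
      proof (cases "x \<in> ball 0 r")
        case True
        have "ennreal (g powr (1 / p)) \<le> ennreal (harmonic_ext s ?u x 1)"
          using mass True assms by (subst harmonic_ext_indicator) auto
        then have "g powr (1 / p) \<le> harmonic_ext s ?u x 1"
          using assms harmonic_ext_indicator(2)[of s 1 "ball 0 (r + M)" x] by simp
        then have "(g powr (1 / p)) powr p \<le> \<bar>harmonic_ext s ?u x 1\<bar> powr p"
          using assms by (intro powr_mono2) auto
        then show ?thesis
          using True g assms by (simp add: powr_powr mult_right_mono flip: ennreal_mult')
      qed simp
    qed
    also have "\<dots> \<le> ennreal C * weighted_integral \<alpha> p 1 ?u"
    proof -
      have "?u \<in> borel_measurable lebesgue" by (intro measurable_completion) measurable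
      moreover have "weighted_integral \<alpha> p 1 ?u < \<infinity>"
        unfolding wi using J_le[of "r + M"] that M by (auto intro: le_less_trans)
      ultimately show ?thesis
        using adm unfolding admissible_const_def by auto
    qed
    finally have "ennreal (1 / g) * (ennreal g * J r) \<le> ennreal (1 / g) * (ennreal C * J (r + M))"
      unfolding wi by (rule mult_left_mono) simp
    then show ?thesis
      using g C by (simp add: mult.assoc[symmetric] q_def flip: ennreal_mult')
  qed
  have iter: "J M \<le> ennreal (q ^ k) * J (M + real k * M)" for k
  proof (induction k)
    case (Suc k)
    have "J (M + real k * M) \<le> ennreal q * J (M + real k * M + M)"
      using M by (intro step) simp
    then have "ennreal (q ^ k) * J (M + real k * M) \<le> ennreal (q ^ k) * (ennreal q * J (M + real k * M + M))"
      by (rule mult_left_mono) simp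
    also have "\<dots> = ennreal (q ^ Suc k) * J (M + real (Suc k) * M)"
      using q by (simp add: mult.assoc[symmetric] algebra_simps flip: ennreal_mult')
    finally show ?case using Suc.IH by (rule order_trans[rotated])
  qed simp
  have bound: "J M \<le> ennreal (q ^ k * (?V * (M + real k * M) ^ ?n))" for k
    using order_trans[OF iter[of k] mult_left_mono[OF J_le[of "M + real k * M"]]] M q
    by (simp add: ennreal_mult')
  have "(\<lambda>k::nat. q ^ k * (1 + real k) ^ ?n) \<longlonglongrightarrow> 0"
    using q by real_asymp
  then have "(\<lambda>k. (?V * M ^ ?n) * (q ^ k * (1 + real k) ^ ?n)) \<longlonglongrightarrow> (?V * M ^ ?n) * 0"
    by (rule tendsto_mult_left)
  also have "(\<lambda>k. (?V * M ^ ?n) * (q ^ k * (1 + real k) ^ ?n)) = (\<lambda>k. q ^ k * (?V * (M + real k * M) ^ ?n))"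
  proof
    fix k :: nat
    have "(M + real k * M) ^ ?n = M ^ ?n * (1 + real k) ^ ?n"
      by (simp add: algebra_simps flip: power_mult_distrib)
    then show "(?V * M ^ ?n) * (q ^ k * (1 + real k) ^ ?n) = q ^ k * (?V * (M + real k * M) ^ ?n)"
      by simp
  qed
  finally have "(\<lambda>k. ennreal (q ^ k * (?V * (M + real k * M) ^ ?n))) \<longlonglongrightarrow> ennreal 0"
    by (intro tendsto_ennrealI) simp
  then have "J M \<le> ennreal 0"
    by (rule LIMSEQ_le_const) (use bound in auto)
  with J_pos show False by simp
qed

section \<open>A gap above 1 for integrable weights\<close>

text \<open>
  A Harnack-type bound: moving the centre by at most \<open>\<epsilon>\<close> changes the kernel only by a factor that is
  close to 1, uniformly in \<open>\<xi>\<close>, because \<open>(1 - \<epsilon>) (|\<xi>|\<^sup>2 + 1) \<le> |x - \<xi>|\<^sup>2 + 1\<close>.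
\<close>

lemma weight_shift_le:
  fixes x \<xi> :: "'a::euclidean_space"
  assumes "norm x \<le> \<epsilon>" "\<epsilon> < 1" "0 \<le> a"
  shows "weight a 1 (x - \<xi>) \<le> (1 - \<epsilon>) powr (- a) * weight a 1 \<xi>"
proof -
  have "0 \<le> \<epsilon>" using assms(1) norm_ge_zero order_trans by blast
  have "2 * norm \<xi> * norm x \<le> 2 * norm \<xi> * \<epsilon>"
    using assms by (intro mult_left_mono) auto
  also have "\<dots> \<le> \<epsilon> * ((norm \<xi>)\<^sup>2 + 1)"
    using \<open>0 \<le> \<epsilon>\<close> mult_left_mono[OF sum_squares_bound[of "norm \<xi>" 1], of \<epsilon>] by (simp add: mult_ac)
  finally have cross: "2 * norm \<xi> * norm x \<le> \<epsilon> * ((norm \<xi>)\<^sup>2 + 1)" .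
  have "(1 - \<epsilon>) * ((norm \<xi>)\<^sup>2 + 1) \<le> (norm \<xi> - norm x)\<^sup>2 + 1"
  proof -
    have "(1 - \<epsilon>) * ((norm \<xi>)\<^sup>2 + 1) = (norm \<xi>)\<^sup>2 + 1 - \<epsilon> * ((norm \<xi>)\<^sup>2 + 1)"
      by (simp add: algebra_simps)
    with cross zero_le_power2[of "norm x"] show ?thesis
      unfolding power2_diff by linarith
  qed
  also have "(norm \<xi> - norm x)\<^sup>2 \<le> (norm (x - \<xi>))\<^sup>2"
    using norm_triangle_ineq3[of \<xi> x] abs_le_square_iff[of "norm \<xi> - norm x" "norm (x - \<xi>)"]
    by (simp add: norm_minus_commute)
  finally have "(1 - \<epsilon>) * ((norm \<xi>)\<^sup>2 + 1) \<le> (norm (x - \<xi>))\<^sup>2 + 1" by simp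
  then have "((norm (x - \<xi>))\<^sup>2 + 1) powr (- a) \<le> ((1 - \<epsilon>) * ((norm \<xi>)\<^sup>2 + 1)) powr (- a)"
    using assms by (intro powr_mono2') (auto intro!: mult_pos_pos add_nonneg_pos)
  then show ?thesis
    using assms by (simp add: weight_def powr_mult)
qed

text \<open>
  The weight is less than 1 away from the origin, so its mean is less than 1 = \<open>w(0)\<close>.
\<close>

lemma poisson_avg_weight_at_0:
  assumes "0 < s" "0 < \<alpha>"
  shows "poisson_avg s 1 (\<lambda>\<xi>. ennreal (weight \<alpha> 1 \<xi>)) (0 :: real ^ 'n::finite) < 1"
proof -
  let ?k = "\<lambda>\<xi> :: real ^ 'n. poisson_kernel s 1 (0 - \<xi>)"
  have pos: "0 < ?k \<xi>" for \<xi> using assms by (simp add: poisson_kernel_pos)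
  have le: "ennreal (?k \<xi>) * ennreal (weight \<alpha> 1 \<xi>) \<le> ennreal (?k \<xi>)" for \<xi>
    using weight_1_le_1[of \<alpha> \<xi>] pos[of \<xi>] assms
    by (simp add: mult_left_le less_imp_le flip: ennreal_mult')
  have lt: "\<not> ennreal (?k \<xi>) \<le> ennreal (?k \<xi>) * ennreal (weight \<alpha> 1 \<xi>)" if "\<xi> \<noteq> 0" for \<xi>
  proof -
    have "weight \<alpha> 1 \<xi> < 1"
      unfolding weight_def using that assms powr_less_mono2_neg[of "- \<alpha>" 1 "(norm \<xi>)\<^sup>2 + 1"] by simp
    then show ?thesis
      using pos[of \<xi>] by (simp add: not_le flip: ennreal_mult')
  qed
  have one: "(\<integral>\<^sup>+\<xi>. ennreal (?k \<xi>) \<partial>lborel) = 1"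
    using poisson_avg_1[of s 1 "0 :: real ^ 'n"] assms by (simp add: poisson_avg_def)
  have "(\<integral>\<^sup>+\<xi>. ennreal (?k \<xi>) * ennreal (weight \<alpha> 1 \<xi>) \<partial>lborel) < (\<integral>\<^sup>+\<xi>. ennreal (?k \<xi>) \<partial>lborel)"
  proof (rule nn_integral_less)
    have "(\<integral>\<^sup>+\<xi>. ennreal (?k \<xi>) * ennreal (weight \<alpha> 1 \<xi>) \<partial>lborel) \<le> (\<integral>\<^sup>+\<xi>. ennreal (?k \<xi>) \<partial>lborel)"
      by (intro nn_integral_mono le)
    then show "(\<integral>\<^sup>+\<xi>. ennreal (?k \<xi>) * ennreal (weight \<alpha> 1 \<xi>) \<partial>lborel) \<noteq> \<infinity>"
      using one by (auto simp: top_unique)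
    show "\<not> (AE \<xi> in lborel. ennreal (?k \<xi>) \<le> ennreal (?k \<xi>) * ennreal (weight \<alpha> 1 \<xi>))"
    proof
      assume "AE \<xi> in lborel. ennreal (?k \<xi>) \<le> ennreal (?k \<xi>) * ennreal (weight \<alpha> 1 \<xi>)"
      then have "AE \<xi> :: real ^ 'n in lborel. False"
        using AE_lborel_singleton[of "0 :: real ^ 'n"] by eventually_elim (use lt in blast)
      then show False by (simp add: eventually_False ae_filter_eq_bot_iff)
    qed
  qed (use le in auto)
  then show ?thesis
    unfolding one by (simp add: poisson_avg_def)
qed

text \<open>
  The strict inequality \<open>P w < w\<close> at the origin extends, with a uniform gap, to a small ball: the
  upper bound for \<open>P w\<close> comes from \<open>weight_shift_le\<close>.
\<close>

lemma poisson_avg_weight_gap: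
  assumes "0 < s" "0 < \<alpha>"
  shows "\<exists>\<epsilon>>0. \<exists>m\<^sub>1 m\<^sub>2. 0 \<le> m\<^sub>1 \<and> m\<^sub>1 < m\<^sub>2 \<and> (\<forall>(x::real^'n::finite)\<in>ball 0 \<epsilon>.
    poisson_avg s 1 (\<lambda>\<xi>. ennreal (weight \<alpha> 1 \<xi>)) x \<le> ennreal m\<^sub>1 \<and> m\<^sub>2 \<le> weight \<alpha> 1 x)"
proof -
  let ?P = "poisson_avg s 1 (\<lambda>\<xi>. ennreal (weight \<alpha> 1 \<xi>)) :: real ^ 'n \<Rightarrow> ennreal"
  define a where "a = real CARD('n) / 2 + s"
  have a: "0 \<le> a" using assms by (simp add: a_def)
  obtain \<kappa> where \<kappa>: "?P 0 = ennreal \<kappa>" "0 \<le> \<kappa>" "\<kappa> < 1"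
    using poisson_avg_weight_at_0[OF assms, where 'n = 'n] by (cases "?P 0") auto
  have "((\<lambda>\<epsilon>. (1 - \<epsilon>) powr (- a) * \<kappa>) \<longlongrightarrow> (1 - 0) powr (- a) * \<kappa>) (at_right 0)"
    by (intro tendsto_intros) auto
  moreover have "((\<lambda>\<epsilon>::real. (\<epsilon>\<^sup>2 + 1\<^sup>2) powr (- \<alpha>)) \<longlongrightarrow> (0\<^sup>2 + 1\<^sup>2) powr (- \<alpha>)) (at_right 0)"
    by (intro tendsto_intros) auto
  ultimately have "((\<lambda>\<epsilon>. (\<epsilon>\<^sup>2 + 1\<^sup>2) powr (- \<alpha>) - (1 - \<epsilon>) powr (- a) * \<kappa>) \<longlongrightarrow> 1 - \<kappa>) (at_right 0)"
    using tendsto_diff by fastforce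
  then have "eventually (\<lambda>\<epsilon>. 0 < (\<epsilon>\<^sup>2 + 1\<^sup>2) powr (- \<alpha>) - (1 - \<epsilon>) powr (- a) * \<kappa>) (at_right 0)"
    using \<kappa>(3) by (intro order_tendstoD(1)) auto
  then have "eventually (\<lambda>\<epsilon>. (1 - \<epsilon>) powr (- a) * \<kappa> < (\<epsilon>\<^sup>2 + 1\<^sup>2) powr (- \<alpha>)) (at_right 0)"
    by eventually_elim simp
  moreover have "eventually (\<lambda>\<epsilon>::real. \<epsilon> \<in> {0<..<1}) (at_right 0)"
    by (rule eventually_at_right_real) simp
  ultimately have "eventually (\<lambda>\<epsilon>. (1 - \<epsilon>) powr (- a) * \<kappa> < (\<epsilon>\<^sup>2 + 1\<^sup>2) powr (- \<alpha>) \<and> \<epsilon> \<in> {0<..<1}) (at_right 0)"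
    by (rule eventually_conj)
  then obtain \<epsilon> where \<epsilon>: "(1 - \<epsilon>) powr (- a) * \<kappa> < (\<epsilon>\<^sup>2 + 1\<^sup>2) powr (- \<alpha>)" "0 < \<epsilon>" "\<epsilon> < 1"
    using eventually_happens'[OF trivial_limit_at_right_real] by fastforce
  have "?P x \<le> ennreal ((1 - \<epsilon>) powr (- a) * \<kappa>)" if "norm x < \<epsilon>" for x
  proof -
    have "?P x \<le> (\<integral>\<^sup>+(\<xi>::real^'n). ennreal ((1 - \<epsilon>) powr (- a)) * (ennreal (poisson_kernel s 1 (0 - \<xi>)) * ennreal (weight \<alpha> 1 \<xi>)) \<partial>lborel)"
      unfolding poisson_avg_def
    proof (rule nn_integral_mono)
      fix \<xi> :: "real ^ 'n"
      have "poisson_kernel s 1 (x - \<xi>) \<le> (1 - \<epsilon>) powr (- a) * poisson_kernel s 1 (0 - \<xi>)"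
        using mult_left_mono[OF weight_shift_le[of x \<epsilon> a \<xi>], of "poisson_const CARD('n) s"]
          that \<epsilon> a poisson_const_pos[OF assms(1), of "CARD('n)"]
        by (simp add: poisson_kernel_def a_def[symmetric] weight_def[of _ _ "- \<xi>"] weight_def[of _ _ \<xi>] mult_ac)
      then have "poisson_kernel s 1 (x - \<xi>) * weight \<alpha> 1 \<xi> \<le> (1 - \<epsilon>) powr (- a) * poisson_kernel s 1 (0 - \<xi>) * weight \<alpha> 1 \<xi>"
        by (rule mult_right_mono) simp
      then show "ennreal (poisson_kernel s 1 (x - \<xi>)) * ennreal (weight \<alpha> 1 \<xi>)
        \<le> ennreal ((1 - \<epsilon>) powr (- a)) * (ennreal (poisson_kernel s 1 (0 - \<xi>)) * ennreal (weight \<alpha> 1 \<xi>))"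
        using poisson_kernel_pos[OF assms(1), of 1, THEN less_imp_le, of "x - \<xi>"]
          poisson_kernel_pos[OF assms(1), of 1, THEN less_imp_le, of "0 - \<xi>"]
        by (simp add: mult.assoc flip: ennreal_mult')
    qed
    also have "\<dots> = ennreal ((1 - \<epsilon>) powr (- a)) * ?P 0"
      unfolding poisson_avg_def by (rule nn_integral_cmult) measurable
    finally show ?thesis by (simp add: \<kappa> ennreal_mult')
  qed
  moreover have "(\<epsilon>\<^sup>2 + 1\<^sup>2) powr (- \<alpha>) \<le> weight \<alpha> 1 x" if "norm x < \<epsilon>" for x :: "real ^ 'n"
    using that assms by (intro weight_ge) auto
  ultimately show ?thesis
    using \<epsilon> \<kappa> by (intro exI[of _ \<epsilon>] conjI exI[of _ "(1 - \<epsilon>) powr (- a) * \<kappa>"] exI[of _ "(\<epsilon>\<^sup>2 + 1\<^sup>2) powr (- \<alpha>)"]) auto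
qed

lemma ennreal_less_of_add_eq:
  fixes a b c d :: ennreal
  assumes "a + b = c + d" "d < b" "a \<noteq> \<infinity>"
  shows "a < c"
  using assms by (cases a; cases b; cases c; cases d)
    (auto simp: ennreal_less_iff simp flip: ennreal_plus)

text \<open>
  \<open>P\<close> preserves the total mass of \<open>w\<close> and decreases its mass on a small ball, so it increases the
  mass on the complement \<open>A\<close> of the ball. By symmetry of \<open>P\<close> this is a statement about the
  extension of the indicator of \<open>A\<close>.
\<close>

lemma exterior_mass_increases:
  assumes "0 < s" "real CARD('n::finite) / 2 < \<alpha>"
  shows "\<exists>A \<in> sets (borel :: (real ^ 'n) measure).
    (\<integral>\<^sup>+x. indicator A x * ennreal (weight \<alpha> 1 x) \<partial>lborel)
      < (\<integral>\<^sup>+x. poisson_avg s 1 (indicator A) x * ennreal (weight \<alpha> 1 x) \<partial>lborel)"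
proof -
  let ?w = "\<lambda>x :: real ^ 'n. ennreal (weight \<alpha> 1 x)"
  let ?P = "poisson_avg s 1 ?w"
  let ?L = "\<lambda>S f. \<integral>\<^sup>+x. indicator S x * f x \<partial>lborel :: (real ^ 'n) measure"
  have "0 < \<alpha>" using assms(2) by (rule le_less_trans[rotated]) simp
  then obtain \<epsilon> m\<^sub>1 m\<^sub>2 where \<epsilon>: "0 < \<epsilon>" "0 \<le> m\<^sub>1" "m\<^sub>1 < m\<^sub>2"
    and gap: "\<And>x::real^'n. x \<in> ball 0 \<epsilon> \<Longrightarrow> ?P x \<le> ennreal m\<^sub>1 \<and> m\<^sub>2 \<le> weight \<alpha> 1 x"
    using poisson_avg_weight_gap[OF assms(1), where 'n = 'n] by meson
  let ?B = "ball (0 :: real ^ 'n) \<epsilon>"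
  have split: "?L (- ?B) f + ?L ?B f = (\<integral>\<^sup>+x. f x \<partial>lborel)" if [measurable]: "f \<in> borel_measurable borel" for f
    by (subst nn_integral_add[symmetric]) (auto intro!: nn_integral_cong simp: indicator_def)
  have W: "(\<integral>\<^sup>+x. ?w x \<partial>lborel) < \<infinity>"
    using assms(2) by (simp add: nn_integral_weight)
  have eq: "(\<integral>\<^sup>+x. ?P x \<partial>lborel) = (\<integral>\<^sup>+x. ?w x \<partial>lborel)"
    using poisson_avg_self_adjoint[of ?w "\<lambda>_. 1" s 1] assms by (simp add: poisson_avg_1)
  define vol where "vol = unit_ball_vol (real CARD('n)) * \<epsilon> ^ CARD('n)"
  have vol: "0 < vol" "emeasure lborel ?B = ennreal vol"
    using \<epsilon> by (simp_all add: vol_def emeasure_ball)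
  have "?L ?B ?P \<le> (\<integral>\<^sup>+x. ennreal m\<^sub>1 * indicator ?B x \<partial>lborel)"
    using gap by (intro nn_integral_mono) (auto simp: indicator_def)
  also have "\<dots> = ennreal (m\<^sub>1 * vol)"
    using vol \<epsilon> by (subst nn_integral_cmult) (auto simp: ennreal_mult')
  also have "\<dots> < ennreal (m\<^sub>2 * vol)"
    using vol \<epsilon> by (intro ennreal_lessI) auto
  also have "\<dots> = (\<integral>\<^sup>+x. ennreal m\<^sub>2 * indicator ?B x \<partial>lborel)"
    using vol \<epsilon> by (subst nn_integral_cmult) (auto simp: ennreal_mult')
  also have "\<dots> \<le> ?L ?B ?w"
    using gap by (intro nn_integral_mono) (auto simp: indicator_def intro!: ennreal_leI)
  finally have lt: "?L ?B ?P < ?L ?B ?w" .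
  have "?L (- ?B) ?w + ?L ?B ?w = ?L (- ?B) ?P + ?L ?B ?P"
    by (simp add: split eq)
  moreover have "?L (- ?B) ?w \<noteq> \<infinity>"
  proof -
    have "?L (- ?B) ?w \<le> ?L (- ?B) ?w + ?L ?B ?w" by simp
    with W show ?thesis by (subst (asm) split) auto
  qed
  ultimately have "?L (- ?B) ?w < ?L (- ?B) ?P"
    by (rule ennreal_less_of_add_eq[OF _ lt])
  moreover have "?L (- ?B) ?P = (\<integral>\<^sup>+x. poisson_avg s 1 (indicator (- ?B)) x * ?w x \<partial>lborel)"
    by (rule poisson_avg_self_adjoint[symmetric]) measurable
  ultimately show ?thesis
    by (intro bexI[of _ "- ?B"]) auto
qed

text \<open>
  On the unit interval the passage from exponent 1 to \<open>p\<close> costs at most \<open>p - 1\<close>, uniformly in \<open>h\<close>: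
  \<open>h powr p \<ge> h + (p - 1) h ln h\<close> by convexity of the exponential function, and \<open>h ln h \<ge> -1\<close>.
\<close>

lemma le_powr_add:
  fixes h p :: real
  assumes "0 \<le> h" "h \<le> 1" "1 \<le> p"
  shows "h \<le> h powr p + (p - 1)"
proof (cases "h = 0")
  case False
  then have h: "0 < h" using assms by simp
  have "h * (1 + (p - 1) * ln h) \<le> h * exp ((p - 1) * ln h)"
    using h exp_ge_add_one_self by (intro mult_left_mono) auto
  also have "\<dots> = h powr p"
    using h by (simp add: powr_def left_diff_distrib exp_diff)
  finally have "h + (p - 1) * (h * ln h) \<le> h powr p"
    by (simp add: algebra_simps)
  moreover have "- 1 \<le> h * ln h"
  proof -
    have "- ln h \<le> 1 / h - 1"
      using ln_le_minus_one[of "1 / h"] h by (simp add: ln_div)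
    then have "h * (- ln h) \<le> h * (1 / h - 1)" using h by (intro mult_left_mono) auto
    then show ?thesis using h by (simp add: right_diff_distrib)
  qed
  then have "(p - 1) * (- 1) \<le> (p - 1) * (h * ln h)"
    using assms by (intro mult_left_mono) auto
  ultimately show ?thesis by simp
qed (use assms in auto)

text \<open>
  Let \<open>W\<close> be the mass of the weight, and \<open>I < H\<close> the two sides of \<open>exterior_mass_increases\<close>. For an
  admissible \<open>C\<close> the test function gives \<open>H - (p - 1) W \<le> C I\<close>. If \<open>p - 1\<close> is less than
  \<open>\<delta> = (H - I) / (2 W)\<close>, then at least half of the gain \<open>H - I\<close> survives, and \<open>I \<le> W\<close> turns it into
  \<open>1 + \<delta> \<le> C\<close>.
\<close>

theorem admissible_const_gap:
  assumes "0 < s" "real CARD('n::finite) / 2 < \<alpha>"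
  shows "\<exists>p\<^sub>0>1. \<exists>c>1. \<forall>p C. 1 \<le> p \<longrightarrow> p < p\<^sub>0 \<longrightarrow> admissible_const TYPE('n) s \<alpha> p C \<longrightarrow> c \<le> C"
proof -
  let ?w = "\<lambda>x :: real ^ 'n. ennreal (weight \<alpha> 1 x)"
  obtain A :: "(real ^ 'n) set" where A [measurable]: "A \<in> sets borel"
    and lt: "(\<integral>\<^sup>+x. indicator A x * ?w x \<partial>lborel) < (\<integral>\<^sup>+x. poisson_avg s 1 (indicator A) x * ?w x \<partial>lborel)"
    using exterior_mass_increases[OF assms] by blast
  have \<alpha>: "0 \<le> \<alpha>" using assms(2) by (smt (verit) divide_nonneg_nonneg of_nat_0_le_iff)
  define h where "h x = harmonic_ext s (indicator A) x 1" for x :: "real ^ 'n"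
  have h: "0 \<le> h x" "h x \<le> 1" and h_eq: "ennreal (h x) = poisson_avg s 1 (indicator A) x" for x
    using harmonic_ext_indicator[of s 1 A x] assms(1) by (auto simp: h_def)
  have [measurable]: "h \<in> borel_measurable borel"
  proof -
    have "h = (\<lambda>x. enn2real (poisson_avg s 1 (indicator A) x))"
      using h by (auto simp flip: h_eq)
    then show ?thesis by simp
  qed
  obtain W where W: "(\<integral>\<^sup>+x. ?w x \<partial>lborel) = ennreal W" "0 \<le> W"
    using assms(2) by (cases "\<integral>\<^sup>+x. ?w x \<partial>lborel") (auto simp: nn_integral_weight)
  have below: "\<exists>r\<ge>0. (\<integral>\<^sup>+x. f x * ?w x \<partial>lborel) = ennreal r \<and> r \<le> W" if "\<And>x. f x \<le> 1" for f :: "real ^ 'n \<Rightarrow> ennreal"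
  proof -
    have "(\<integral>\<^sup>+x. f x * ?w x \<partial>lborel) \<le> ennreal W"
      unfolding W(1)[symmetric] using mult_right_mono[OF that] by (intro nn_integral_mono) auto
    then show ?thesis
      using W(2) by (cases "\<integral>\<^sup>+x. f x * ?w x \<partial>lborel") (auto simp: top_unique)
  qed
  obtain I where I: "(\<integral>\<^sup>+x. indicator A x * ?w x \<partial>lborel) = ennreal I" "0 \<le> I" "I \<le> W"
  proof -
    have "indicator A x \<le> (1 :: ennreal)" for x :: "real ^ 'n"
      by (simp add: indicator_def)
    from below[of "indicator A", OF this] show ?thesis using that by blast
  qed
  obtain H where H: "(\<integral>\<^sup>+x. ennreal (h x) * ?w x \<partial>lborel) = ennreal H" "0 \<le> H" "H \<le> W"
    using below[of "\<lambda>x. ennreal (h x)"] h by auto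
  have "I < H"
    using lt I H by (simp add: h_eq ennreal_less_iff)
  with I H have D: "0 < H - I" "0 < W" by auto
  define \<delta> where "\<delta> = (H - I) / (2 * W)"
  have \<delta>: "0 < \<delta>" using D by (simp add: \<delta>_def)
  show ?thesis
  proof (intro exI[of _ "1 + \<delta>"] conjI allI impI)
    fix p C :: real
    assume p: "1 \<le> p" "p < 1 + \<delta>" and adm: "admissible_const TYPE('n) s \<alpha> p C"
    have C: "0 < C" using adm by (simp add: admissible_const_def)
    have wi: "weighted_integral \<alpha> p 1 (indicator A :: real ^ 'n \<Rightarrow> real) = ennreal I"
      using I by (simp add: weighted_integral_indicator)
    have "(indicator A :: real ^ 'n \<Rightarrow> real) \<in> borel_measurable lebesgue"
      by (intro measurable_completion) measurable
    moreover have "weighted_integral \<alpha> p 1 (indicator A :: real ^ 'n \<Rightarrow> real) < \<infinity>"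
      by (simp add: wi)
    ultimately have le: "weighted_integral \<alpha> p 1 h \<le> ennreal C * ennreal I"
      using adm[unfolded admissible_const_def, THEN conjunct2, rule_format, of 1 "indicator A"]
      unfolding wi h_def by simp
    \<comment> \<open>The loss in passing from \<open>h\<close> to \<open>h powr p\<close> is charged to the weight.\<close>
    have "ennreal H \<le> (\<integral>\<^sup>+x. ennreal (\<bar>h x\<bar> powr p * weight \<alpha> 1 x) + ennreal (p - 1) * ?w x \<partial>lborel)"
      unfolding H(1)[symmetric]
    proof (rule nn_integral_mono)
      fix x
      have "h x * weight \<alpha> 1 x \<le> (h x powr p + (p - 1)) * weight \<alpha> 1 x"
        using le_powr_add[of "h x" p] h p by (intro mult_right_mono) auto
      then show "ennreal (h x) * ?w x \<le> ennreal (\<bar>h x\<bar> powr p * weight \<alpha> 1 x) + ennreal (p - 1) * ?w x"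
        using h[of x] p by (simp add: distrib_right flip: ennreal_mult' ennreal_plus)
    qed
    also have "\<dots> = weighted_integral \<alpha> p 1 h + ennreal (p - 1) * ennreal W"
      unfolding weighted_integral_eq W(1)[symmetric]
      by (subst nn_integral_add) (auto simp: nn_integral_cmult)
    also have "\<dots> \<le> ennreal C * ennreal I + ennreal (p - 1) * ennreal W"
      using le by (rule add_right_mono)
    also have "\<dots> = ennreal (C * I + (p - 1) * W)"
      using C I p W by (simp add: ennreal_mult' ennreal_plus)
    finally have "H \<le> C * I + (p - 1) * W"
      using C I p W by (subst (asm) ennreal_le_iff) auto
    moreover have "(p - 1) * W \<le> \<delta> * W"
      using p W by (intro mult_right_mono) auto
    moreover have "\<delta> * W = (H - I) / 2"
      using D by (simp add: \<delta>_def)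
    ultimately have gain: "\<delta> * W \<le> (C - 1) * I"
      by (simp add: algebra_simps)
    have "1 \<le> C"
    proof (rule ccontr)
      assume "\<not> 1 \<le> C"
      then have "(C - 1) * I \<le> 0" using I by (intro mult_nonpos_nonneg) auto
      with gain mult_pos_pos[OF \<delta> D(2)] show False by linarith
    qed
    then have "(C - 1) * I \<le> (C - 1) * W" using I by (intro mult_left_mono) auto
    with gain have "\<delta> * W \<le> (C - 1) * W" by linarith
    then show "1 + \<delta> \<le> C" using D by simp
  qed (use \<delta> in auto)
qed

section \<open>The best constant\<close>

theorem theorem2:
  fixes s \<alpha> :: real
  assumes "0 < s" and "s < 1" and "0 \<le> \<alpha>"
  shows "(\<alpha> \<le> real CARD('n::finite) / 2 - s \<longrightarrow>
            (\<forall>p\<ge>1. best_const TYPE('n) s \<alpha> p = 1)) \<and>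
         (real CARD('n) / 2 < \<alpha> \<longrightarrow>
            (\<exists>p\<^sub>0>1. \<forall>p. 1 \<le> p \<and> p < p\<^sub>0 \<longrightarrow> best_const TYPE('n) s \<alpha> p > 1))"
proof (intro conjI impI allI)
  fix p :: real
  assume "\<alpha> \<le> real CARD('n) / 2 - s" "1 \<le> p"
  then have "admissible_const TYPE('n) s \<alpha> p 1"
    using assms by (intro admissible_const_1) auto
  then have "best_const TYPE('n) s \<alpha> p \<le> ennreal 1"
    unfolding best_const_def by (intro Inf_lower imageI) simp
  moreover have "ennreal 1 \<le> best_const TYPE('n) s \<alpha> p"
    unfolding best_const_def using admissible_const_ge_1[OF assms(1,3) \<open>1 \<le> p\<close>]
    by (intro Inf_greatest) (auto intro!: ennreal_leI)
  ultimately show "best_const TYPE('n) s \<alpha> p = 1" by simp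
next
  assume "real CARD('n) / 2 < \<alpha>"
  then obtain p\<^sub>0 c where "1 < p\<^sub>0" "1 < c"
    and gap: "\<And>p C. 1 \<le> p \<Longrightarrow> p < p\<^sub>0 \<Longrightarrow> admissible_const TYPE('n) s \<alpha> p C \<Longrightarrow> c \<le> C"
    using admissible_const_gap[OF assms(1)] by meson
  have "1 < best_const TYPE('n) s \<alpha> p" if "1 \<le> p" "p < p\<^sub>0" for p
  proof -
    have "1 < ennreal c" using \<open>1 < c\<close> by simp
    also have "ennreal c \<le> best_const TYPE('n) s \<alpha> p"
      unfolding best_const_def using gap[OF that] by (intro Inf_greatest) (auto intro!: ennreal_leI)
    finally show ?thesis .
  qed
  with \<open>1 < p\<^sub>0\<close> show "\<exists>p\<^sub>0>1. \<forall>p. 1 \<le> p \<and> p < p\<^sub>0 \<longrightarrow> 1 < best_const TYPE('n) s \<alpha> p"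
    by blast
qed

end
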